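(* Let $G=\langle a,b,b'\mid a^2=b^2=b'^2=1,\ ab=b'a\rangle$. For an oriented chord diagram $D$ with base point $X$, the conjugacy class of the element $[\gamma(D,X)]$ in $G$ is an invariant of free knots: if $D$ and $D'$ represent the same free knot, then for any base points $X$ on $D$ and $X'$ on $D'$ the elements $[\gamma(D,X)]$ and $[\gamma(D',X')]$ are conjugate in $G$.
   Context: A chord diagram is an oriented circle with finitely many chords having pairwise distinct ends; a base point $X$ is a point of the circle distinct from all chord ends. Chord diagrams encode framed 4-graphs with one unicursal component (one chord per vertex, joining the two preimages of the vertex on the circle traversing the component). A free knot is an equivalence class of such diagrams modulo the Reidemeister moves: (1) addition/removal of a chord whose two ends are adjacent on the circle; (2) addition/removal of two chords $p,q$ such that there are two disjoint arcs of the circle, each containing exactly one end of $p$, one end of $q$ and no other chord ends; (3) for three chords $p,q,r$ such that there are three disjoint arcs of the circle, one containing exactly one end of $p$ and one end of $q$, one exactly one end of $q$ and one end of $r$, one exactly one end of $p$ and one end of $r$, and no other chord ends, the order of the two ends on each of the three arcs is switched. Two chords are linked if the ends of one lie in different components of the circle minus the ends of the other. A chord is even if it is linked with an even number of other chords, and odd otherwise. An odd chord is of the first type if it is linked with an odd number of odd chords, and of the second type if it is linked with an odd number of even chords. The word $\gamma(D,X)$ in the alphabet $a,b,b'$ is obtained by walking along the oriented circle once starting from $X$ and writing, at each chord end met, the letter $a$ if the chord is even, $b$ if it is odd of the first type, and $b'$ if it is odd of the second type. $[\gamma(D,X)]$ is the element of $G$ represented by this word. *)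

theory Defs
  imports "HOL-Analysis.Analysis" "HOL-Combinatorics.Transposition" "HOL-Algebra.Group"
begin

section \<open>Groups given by generators and relations\<close>

text \<open>
  A word is a list of signed generators; \<open>(x, True)\<close> stands for the generator \<open>x\<close> and
  \<open>(x, False)\<close> for its formal inverse. A relation \<open>(l, r)\<close> stands for the equation \<open>l = r\<close>.
\<close>

type_synonym 'g gword = "('g \<times> bool) list"

inductive pres_eq :: "('g gword \<times> 'g gword) set \<Rightarrow> 'g gword \<Rightarrow> 'g gword \<Rightarrow> bool"
  for R :: "('g gword \<times> 'g gword) set" where
  cancel: "pres_eq R (u @ [(x, s), (x, \<not> s)] @ v) (u @ v)"
| relation: "(l, r) \<in> R \<Longrightarrow> pres_eq R (u @ l @ v) (u @ r @ v)"
| refl: "pres_eq R u u"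
| sym: "pres_eq R u v \<Longrightarrow> pres_eq R v u"
| trans: "pres_eq R u v \<Longrightarrow> pres_eq R v w \<Longrightarrow> pres_eq R u w"

definition pres_class :: "('g gword \<times> 'g gword) set \<Rightarrow> 'g gword \<Rightarrow> 'g gword set" where
  "pres_class R w = {v. pres_eq R w v}"

definition presented_group :: "('g gword \<times> 'g gword) set \<Rightarrow> 'g gword set monoid" where
  "presented_group R =
     \<lparr>carrier = range (pres_class R),
      monoid.mult = (\<lambda>A B. \<Union>u\<in>A. \<Union>v\<in>B. pres_class R (u @ v)),
      one = pres_class R []\<rparr>"

lemma pres_eq_context: "pres_eq R u v \<Longrightarrow> pres_eq R (x @ u @ y) (x @ v @ y)"
proof (induction rule: pres_eq.induct)
  case (cancel u z s v)
  show ?case using pres_eq.cancel[of R "x @ u" z s "v @ y"] by simp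
next
  case (relation l r u v)
  then show ?case using pres_eq.relation[of l r R "x @ u" "v @ y"] by simp
next
  case (refl u)
  show ?case by (rule pres_eq.refl)
next
  case (sym u v)
  show ?case by (rule pres_eq.sym[OF sym.IH])
next
  case (trans u v w)
  show ?case by (rule pres_eq.trans[OF trans.IH])
qed

lemma pres_class_eq_iff: "pres_class R u = pres_class R v \<longleftrightarrow> pres_eq R u v"
proof
  assume "pres_class R u = pres_class R v"
  then have "v \<in> pres_class R u" by (simp add: pres_class_def pres_eq.refl)
  then show "pres_eq R u v" by (simp add: pres_class_def)
next
  assume uv: "pres_eq R u v"
  have "pres_eq R u w \<longleftrightarrow> pres_eq R v w" for w
    by (rule iffI) (erule pres_eq.trans[OF pres_eq.sym[OF uv]], erule pres_eq.trans[OF uv])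
  then show "pres_class R u = pres_class R v" by (simp add: pres_class_def)
qed

lemma presented_group_mult:
  "pres_class R u \<otimes>\<^bsub>presented_group R\<^esub> pres_class R v = pres_class R (u @ v)"
proof -
  have eq: "pres_class R (u' @ v') = pres_class R (u @ v)"
    if "u' \<in> pres_class R u" "v' \<in> pres_class R v" for u' v'
  proof -
    have "pres_eq R (u @ v) (u' @ v)" "pres_eq R (u' @ v) (u' @ v')"
      using that pres_eq_context[of R u u' "[]" v] pres_eq_context[of R v v' u' "[]"]
      by (auto simp: pres_class_def)
    then have "pres_eq R (u @ v) (u' @ v')" by (rule pres_eq.trans)
    then show ?thesis unfolding pres_class_eq_iff by (rule pres_eq.sym)
  qed
  have "u \<in> pres_class R u" "v \<in> pres_class R v"
    by (simp_all add: pres_class_def pres_eq.refl)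
  then have "(\<Union>u'\<in>pres_class R u. \<Union>v'\<in>pres_class R v. pres_class R (u' @ v')) =
      pres_class R (u @ v)"
    using eq by blast
  then show ?thesis by (simp add: presented_group_def)
qed

lemma group_presented_group: "group (presented_group R)"
proof (rule groupI)
  let ?inv = "\<lambda>w. rev (map (\<lambda>(x, s). (x, \<not> s)) w)"
  have inv: "pres_eq R (?inv w @ w) []" for w :: "'a gword"
  proof (induction w)
    case (Cons c w)
    obtain x s where c: "c = (x, s)" by force
    have "pres_eq R (?inv w @ [(x, \<not> s), (x, \<not> \<not> s)] @ w) (?inv w @ w)"
      by (rule pres_eq.cancel)
    from pres_eq.trans[OF this Cons.IH] show ?case by (simp add: c)
  qed (simp add: pres_eq.refl)
  fix A assume "A \<in> carrier (presented_group R)"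
  then obtain w where A: "A = pres_class R w" by (auto simp: presented_group_def)
  have "pres_class R (?inv w) \<otimes>\<^bsub>presented_group R\<^esub> A = \<one>\<^bsub>presented_group R\<^esub>"
    using inv[of w] by (simp add: A presented_group_mult pres_class_eq_iff)
      (simp add: presented_group_def pres_class_eq_iff)
  then show "\<exists>B\<in>carrier (presented_group R).
      B \<otimes>\<^bsub>presented_group R\<^esub> A = \<one>\<^bsub>presented_group R\<^esub>"
    by (auto simp: presented_group_def)
  show "\<one>\<^bsub>presented_group R\<^esub> \<otimes>\<^bsub>presented_group R\<^esub> A = A"
    using presented_group_mult[of R "[]" w] by (simp add: A) (simp add: presented_group_def)
next
  fix A B C
  assume "A \<in> carrier (presented_group R)" "B \<in> carrier (presented_group R)"
  then obtain u v where AB: "A = pres_class R u" "B = pres_class R v"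
    by (auto simp: presented_group_def)
  show AB_in: "A \<otimes>\<^bsub>presented_group R\<^esub> B \<in> carrier (presented_group R)"
    unfolding AB presented_group_mult by (simp add: presented_group_def)
  assume "C \<in> carrier (presented_group R)"
  then obtain w where C: "C = pres_class R w" by (auto simp: presented_group_def)
  show "A \<otimes>\<^bsub>presented_group R\<^esub> B \<otimes>\<^bsub>presented_group R\<^esub> C =
      A \<otimes>\<^bsub>presented_group R\<^esub> (B \<otimes>\<^bsub>presented_group R\<^esub> C)"
    by (simp add: AB C presented_group_mult)
qed (simp add: presented_group_def)

definition conjugate_in :: "('g, 'x) monoid_scheme \<Rightarrow> 'g \<Rightarrow> 'g \<Rightarrow> bool" where
  "conjugate_in H x y \<longleftrightarrow>
     x \<in> carrier H \<and> y \<in> carrier H \<and>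
     (\<exists>g\<in>carrier H. y = g \<otimes>\<^bsub>H\<^esub> x \<otimes>\<^bsub>H\<^esub> inv\<^bsub>H\<^esub> g)"

datatype letter = La | Lb | Lb'

definition positive_word :: "'g list \<Rightarrow> 'g gword" where
  "positive_word = map (\<lambda>x. (x, True))"

definition G_relations :: "(letter gword \<times> letter gword) set" where
  "G_relations =
     {(positive_word [La, La], []),
      (positive_word [Lb, Lb], []),
      (positive_word [Lb', Lb'], []),
      (positive_word [La, Lb], positive_word [Lb', La])}"

definition G :: "letter gword set monoid" where
  "G = presented_group G_relations"

definition G_element :: "letter list \<Rightarrow> letter gword set" where
  "G_element w = pres_class G_relations (positive_word w)"


section \<open>Chord diagrams\<close>

text \<open>
  The circle is the unit circle of the complex plane with its counterclockwise orientation, and a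
  chord is identified with the set of its two ends.
\<close>

abbreviation circle :: "complex set" where
  "circle \<equiv> sphere 0 1"

type_synonym chord = "complex set"

definition chord_diagram :: "chord set \<Rightarrow> bool" where
  "chord_diagram D \<longleftrightarrow>
     finite D \<and> (\<forall>c\<in>D. c \<subseteq> circle \<and> card c = 2) \<and> pairwise disjnt D"

definition ends :: "chord set \<Rightarrow> complex set" where
  "ends D = \<Union>D"

definition base_point :: "chord set \<Rightarrow> complex \<Rightarrow> bool" where
  "base_point D X \<longleftrightarrow> X \<in> circle \<and> X \<notin> ends D"

definition linked :: "chord \<Rightarrow> chord \<Rightarrow> bool" where
  "linked p q \<longleftrightarrow>
     (\<exists>U\<in>components (circle - q). \<exists>V\<in>components (circle - q).
        U \<noteq> V \<and> p \<inter> U \<noteq> {} \<and> p \<inter> V \<noteq> {})"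

definition even_chord :: "chord set \<Rightarrow> chord \<Rightarrow> bool" where
  "even_chord D c \<longleftrightarrow> even (card {d \<in> D - {c}. linked c d})"

abbreviation odd_chord :: "chord set \<Rightarrow> chord \<Rightarrow> bool" where
  "odd_chord D c \<equiv> \<not> even_chord D c"

definition first_type :: "chord set \<Rightarrow> chord \<Rightarrow> bool" where
  "first_type D c \<longleftrightarrow>
     odd_chord D c \<and> odd (card {d \<in> D - {c}. linked c d \<and> odd_chord D d})"

definition second_type :: "chord set \<Rightarrow> chord \<Rightarrow> bool" where
  "second_type D c \<longleftrightarrow>
     odd_chord D c \<and> odd (card {d \<in> D - {c}. linked c d \<and> even_chord D d})"

lemma odd_chord_types:
  assumes "chord_diagram D" "odd_chord D c"
  shows "second_type D c \<longleftrightarrow> \<not> first_type D c"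
proof -
  let ?O = "{d \<in> D - {c}. linked c d \<and> odd_chord D d}"
  let ?E = "{d \<in> D - {c}. linked c d \<and> even_chord D d}"
  have "finite D" using assms(1) by (simp add: chord_diagram_def)
  then have "card (?O \<union> ?E) = card ?O + card ?E"
    by (intro card_Un_disjoint) auto
  moreover have "?O \<union> ?E = {d \<in> D - {c}. linked c d}" by blast
  ultimately have "odd (card ?O + card ?E)"
    using assms(2) by (simp add: even_chord_def)
  then show ?thesis using assms(2) by (auto simp: first_type_def second_type_def)
qed

text \<open>By \<open>odd_chord_types\<close>, the last branch is exactly the case of the second type.\<close>

definition chord_letter :: "chord set \<Rightarrow> chord \<Rightarrow> letter" where
  "chord_letter D c = (if even_chord D c then La else if first_type D c then Lb else Lb')"

definition chord_at :: "chord set \<Rightarrow> complex \<Rightarrow> chord" where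
  "chord_at D z = (THE c. c \<in> D \<and> z \<in> c)"

text \<open>The list of angles at which a chord end is met, walking counterclockwise once from \<open>X\<close>.\<close>

definition meeting_angles :: "chord set \<Rightarrow> complex \<Rightarrow> real list" where
  "meeting_angles D X =
     sorted_list_of_set {\<theta> \<in> {0<..<2 * pi}. X * cis \<theta> \<in> ends D}"

definition gamma :: "chord set \<Rightarrow> complex \<Rightarrow> letter list" where
  "gamma D X = map (\<lambda>\<theta>. chord_letter D (chord_at D (X * cis \<theta>))) (meeting_angles D X)"


section \<open>Free knots\<close>

definition circle_arc :: "complex set \<Rightarrow> bool" where
  "circle_arc A \<longleftrightarrow>
     (\<exists>x\<in>circle. \<exists>\<alpha>. 0 < \<alpha> \<and> \<alpha> < 2 * pi \<and> A = (\<lambda>\<theta>. x * cis \<theta>) ` {0<..<\<alpha>})"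

definition arc_with_ends :: "chord set \<Rightarrow> complex set \<Rightarrow> complex \<Rightarrow> complex \<Rightarrow> bool" where
  "arc_with_ends D A x y \<longleftrightarrow> circle_arc A \<and> x \<noteq> y \<and> A \<inter> ends D = {x, y}"

definition add_chord_move :: "chord set \<Rightarrow> chord set \<Rightarrow> bool" where
  "add_chord_move D D' \<longleftrightarrow>
     (\<exists>p1 p2 A. {p1, p2} \<notin> D \<and> D' = D \<union> {{p1, p2}} \<and> arc_with_ends D' A p1 p2)"

definition add_two_chords_move :: "chord set \<Rightarrow> chord set \<Rightarrow> bool" where
  "add_two_chords_move D D' \<longleftrightarrow>
     (\<exists>p q p1 p2 q1 q2 A B.
        p = {p1, p2} \<and> q = {q1, q2} \<and> p \<noteq> q \<and> p \<notin> D \<and> q \<notin> D \<and>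
        D' = D \<union> {p, q} \<and> disjnt A B \<and>
        arc_with_ends D' A p1 q1 \<and> arc_with_ends D' B p2 q2)"

definition three_chords_move :: "chord set \<Rightarrow> chord set \<Rightarrow> bool" where
  "three_chords_move D D' \<longleftrightarrow>
     (\<exists>p q r p1 p2 q1 q2 r1 r2 A B C.
        p = {p1, p2} \<and> q = {q1, q2} \<and> r = {r1, r2} \<and>
        p \<noteq> q \<and> q \<noteq> r \<and> p \<noteq> r \<and> p \<in> D \<and> q \<in> D \<and> r \<in> D \<and>
        disjnt A B \<and> disjnt B C \<and> disjnt A C \<and>
        arc_with_ends D A p1 q1 \<and> arc_with_ends D B q2 r1 \<and> arc_with_ends D C p2 r2 \<and>
        (let switch = Transposition.transpose p1 q1 \<circ> Transposition.transpose q2 r1 \<circ>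
               Transposition.transpose p2 r2
         in D' = (\<lambda>c. switch ` c) ` D))"

text \<open>
  Chord diagrams matter only up to orientation preserving homeomorphism of the circle; preservation
  of the orientation is expressed by an increasing lift to the real line.
\<close>

definition orientation_preserving_homeomorphism :: "(complex \<Rightarrow> complex) \<Rightarrow> bool" where
  "orientation_preserving_homeomorphism h \<longleftrightarrow>
     (\<exists>g. homeomorphism circle circle h g) \<and>
     (\<exists>f :: real \<Rightarrow> real. continuous_on UNIV f \<and> strict_mono f \<and>
        (\<forall>t. f (t + 2 * pi) = f t + 2 * pi) \<and> (\<forall>t. h (cis t) = cis (f t)))"

definition same_diagram :: "chord set \<Rightarrow> chord set \<Rightarrow> bool" where
  "same_diagram D D' \<longleftrightarrow>
     (\<exists>h. orientation_preserving_homeomorphism h \<and> D' = (\<lambda>c. h ` c) ` D)"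

definition diagram_step :: "chord set \<Rightarrow> chord set \<Rightarrow> bool" where
  "diagram_step D D' \<longleftrightarrow>
     chord_diagram D \<and> chord_diagram D' \<and>
     (same_diagram D D' \<or> add_chord_move D D' \<or> add_two_chords_move D D' \<or>
      three_chords_move D D')"

text \<open>Removal of chords is covered by the symmetry of the generated equivalence relation.\<close>

definition free_knot_equiv :: "(chord set \<times> chord set) set" where
  "free_knot_equiv = {(D, D'). chord_diagram D \<and> chord_diagram D' \<and> equivclp diagram_step D D'}"

definition free_knot :: "chord set \<Rightarrow> chord set set" where
  "free_knot D = free_knot_equiv `` {D}"

end

theory Submission
  imports Defs
begin

text \<open>
  Cutting the circle at the base point turns a diagram into a word in which every chord occurs twice;
  linking of chords, and hence the letter of a chord, can be read off this word. A new base point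
  rotates the word, which conjugates the element of \<open>G\<close>. The first two moves insert or delete squares
  of letters. In the third move each of the three chords changes its linking with the other two, and
  the number of odd chords among the three is even: for an outside chord \<open>d\<close>, the number of them
  linked with \<open>d\<close> is even. So the letter \<open>a\<close> is kept, and if there are two odd chords then both
  change between \<open>b\<close> and \<open>b'\<close>, which is exactly what \<open>ab = b'a\<close> compensates when neighbours are
  switched.
\<close>

section \<open>Conjugacy of words in \<open>G\<close>\<close>

text \<open>Linking is defined through components of the circle, whereas the words need only the
  order of the chord ends. Both meet in a word whose letters are the chords themselves: removing
  chords becomes filtering, a homeomorphism becomes a renaming of letters, and the switch in the
  third move becomes a renaming together with the reversal of three pairs of neighbours. For each
  move, equality in \<open>G\<close> is shown for one suitable base point, and the change of base
  point supplies all others. For the three moves this point lies inside one of the arcs, so the pair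
  of ends on that arc closes the word; the other arcs are disjoint from it, hence avoid the base
  point and appear as unbroken pairs of neighbours. The moves do not prescribe the order of the ends
  on an arc, so the word lemmas allow both orders in every pair and thereby cover all shapes of a
  move at once.\<close>

lemma group_G: "group G"
  unfolding G_def by (rule group_presented_group)

lemma G_element_append: "G_element (u @ v) = G_element u \<otimes>\<^bsub>G\<^esub> G_element v"
  by (simp add: G_element_def G_def presented_group_mult positive_word_def)

lemma G_element_in_carrier: "G_element w \<in> carrier G"
  by (simp add: G_element_def G_def presented_group_def)

lemma G_element_eqI:
  "pres_eq G_relations (positive_word u) (positive_word v) \<Longrightarrow> G_element u = G_element v"
  by (simp add: G_element_def pres_class_eq_iff)

lemma G_element_relation:
  assumes "(positive_word u, positive_word v) \<in> G_relations"
  shows "G_element u = G_element v"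
  using pres_eq.relation[OF assms, of "[]" "[]"] by (simp add: G_element_eqI)

lemma G_element_square: "G_element [x, x] = G_element []"
proof (rule G_element_relation)
  show "(positive_word [x, x], positive_word []) \<in> G_relations"
    by (cases x) (auto simp: G_relations_def positive_word_def)
qed

lemma G_element_cancel: "G_element (u @ [x, x] @ v) = G_element (u @ v)"
proof -
  have "G_element (u @ [x, x] @ v) = G_element (u @ [] @ v)"
    using G_element_square[of x] by (simp only: G_element_append)
  then show ?thesis by simp
qed

lemma G_element_a_b: "G_element [La, Lb] = G_element [Lb', La]"
  by (rule G_element_relation) (auto simp: G_relations_def)

text \<open>Multiplying \<open>ab = b'a\<close> by \<open>a\<close> on both sides and cancelling
  squares gives this companion rule.\<close>

lemma G_element_b_a: "G_element [Lb, La] = G_element [La, Lb']"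
proof -
  have "G_element [Lb, La] = G_element ([La] @ [La, Lb] @ [La])"
    using G_element_cancel[of "[]" La "[Lb, La]"] by simp
  also have "\<dots> = G_element ([La] @ [Lb', La] @ [La])"
    using G_element_a_b by (simp only: G_element_append)
  also have "\<dots> = G_element [La, Lb']"
    using G_element_cancel[of "[La, Lb']" La "[]"] by simp
  finally show ?thesis .
qed

lemma conjugate_in_sym:
  assumes "group H" "conjugate_in H x y"
  shows "conjugate_in H y x"
proof -
  interpret group H by fact
  obtain g where g: "x \<in> carrier H" "y \<in> carrier H" "g \<in> carrier H" "y = g \<otimes>\<^bsub>H\<^esub> x \<otimes>\<^bsub>H\<^esub> inv\<^bsub>H\<^esub> g"
    using assms(2) by (auto simp: conjugate_in_def)
  then have "x = inv\<^bsub>H\<^esub> g \<otimes>\<^bsub>H\<^esub> y \<otimes>\<^bsub>H\<^esub> inv\<^bsub>H\<^esub> (inv\<^bsub>H\<^esub> g)"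
    by (simp add: m_assoc flip: m_assoc[of "inv\<^bsub>H\<^esub> g" g])
  with g(1-3) show ?thesis unfolding conjugate_in_def by (metis inv_closed)
qed

lemma conjugate_in_trans:
  assumes "group H" "conjugate_in H x y" "conjugate_in H y z"
  shows "conjugate_in H x z"
proof -
  interpret group H by fact
  obtain g h where g: "x \<in> carrier H" "z \<in> carrier H" "g \<in> carrier H" "h \<in> carrier H"
    "z = h \<otimes>\<^bsub>H\<^esub> (g \<otimes>\<^bsub>H\<^esub> x \<otimes>\<^bsub>H\<^esub> inv\<^bsub>H\<^esub> g) \<otimes>\<^bsub>H\<^esub> inv\<^bsub>H\<^esub> h"
    using assms(2,3) by (auto simp: conjugate_in_def)
  then have "z = (h \<otimes>\<^bsub>H\<^esub> g) \<otimes>\<^bsub>H\<^esub> x \<otimes>\<^bsub>H\<^esub> inv\<^bsub>H\<^esub> (h \<otimes>\<^bsub>H\<^esub> g)"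
    by (simp add: m_assoc inv_mult_group)
  then show ?thesis using g by (auto simp: conjugate_in_def)
qed

text \<open>The conjugating element is the class of \<open>v\<close>.\<close>

lemma conjugate_in_G_rotation:
  "conjugate_in G (G_element (u @ v)) (G_element (v @ u))"
proof -
  interpret group G by (rule group_G)
  have "G_element (v @ u) = G_element v \<otimes>\<^bsub>G\<^esub> G_element (u @ v) \<otimes>\<^bsub>G\<^esub> inv\<^bsub>G\<^esub> (G_element v)"
    by (simp add: G_element_append G_element_in_carrier m_assoc)
  then show ?thesis by (auto simp: conjugate_in_def G_element_in_carrier)
qed

section \<open>Double occurrence words\<close>

text \<open>The two alternating patterns are cyclic shifts of each other, which makes the notion
  insensitive to the base point. For distinct letters either pattern also forces each of them to
  occur exactly twice.\<close>

definition interlaced :: "'a list \<Rightarrow> 'a \<Rightarrow> 'a \<Rightarrow> bool" where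
  "interlaced w c d \<longleftrightarrow>
     filter (\<lambda>x. x = c \<or> x = d) w = [c, d, c, d] \<or> filter (\<lambda>x. x = c \<or> x = d) w = [d, c, d, c]"

text \<open>The predicate \<open>P\<close> lets one definition serve two counts: all linked letters,
  and the linked odd ones. A sum of truth values allows the contributions of single letters to be
  split off.\<close>

definition linking_number :: "'a list \<Rightarrow> ('a \<Rightarrow> bool) \<Rightarrow> 'a \<Rightarrow> nat" where
  "linking_number w P c = (\<Sum>d\<in>set w - {c}. of_bool (interlaced w c d \<and> P d))"

abbreviation even_in :: "'a list \<Rightarrow> 'a \<Rightarrow> bool" where
  "even_in w c \<equiv> even (linking_number w (\<lambda>_. True) c)"

definition letter_type :: "'a list \<Rightarrow> 'a \<Rightarrow> letter" where
  "letter_type w c =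
     (if even_in w c then La
      else if odd (linking_number w (\<lambda>d. \<not> even_in w d) c) then Lb else Lb')"

definition type_word :: "'a list \<Rightarrow> letter list" where
  "type_word w = map (letter_type w) w"

lemma interlaced_commute: "interlaced w c d \<longleftrightarrow> interlaced w d c"
  by (simp add: interlaced_def disj_commute)

lemma filter_notin:
  assumes "p \<notin> set u"
  shows "filter (\<lambda>x. x = p \<or> Q x) u = filter Q u" "filter (\<lambda>x. Q x \<or> x = p) u = filter Q u"
  using assms by (auto intro: filter_cong)

text \<open>The two occurrences of \<open>p\<close> enclose \<open>y\<close>, so alternation means
  one occurrence of \<open>c\<close> inside and one outside. Counts replace list patterns here, so
  that parity arguments apply.\<close>

lemma interlaced_iff_count_list:
  assumes "p \<notin> set x" "p \<notin> set y" "p \<notin> set z" "c \<noteq> p"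
  shows "interlaced (x @ p # y @ p # z) p c \<longleftrightarrow>
    count_list y c = 1 \<and> count_list x c + count_list z c = 1"
proof -
  have rep: "filter (\<lambda>x. x = c) v = replicate (count_list v c) c" for v :: "'a list"
    by (induction v) auto
  have *: "replicate n c = c # v \<longleftrightarrow> (\<exists>m. n = Suc m \<and> v = replicate m c)"
    "p # v \<noteq> replicate n c" "replicate n c \<noteq> p # v" for n v
    using assms(4) by (cases n; auto)+
  have **: "replicate n c @ p # v = p # w \<longleftrightarrow> n = 0 \<and> v = w"
     "replicate n c @ p # v = c # w \<longleftrightarrow> (\<exists>m. n = Suc m \<and> replicate m c @ p # v = w)" for n v w
    using assms(4) by (cases n; auto)+
  show ?thesis
    using assms by (simp add: interlaced_def filter_notin rep ** *) auto
qed

lemma linking_number_cong: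
  assumes "set w = set w'" "\<And>d. d \<in> set w \<Longrightarrow> d \<noteq> c \<Longrightarrow> interlaced w c d = interlaced w' c d"
    "\<And>d. d \<in> set w \<Longrightarrow> P d = P' d"
  shows "linking_number w P c = linking_number w' P' c"
  unfolding linking_number_def using assms by (intro sum.cong) auto

text \<open>Only the interlacement graph enters: it determines the parities, and graph and parities
  together determine the split into \<open>Lb\<close> and \<open>Lb'\<close>.\<close>

lemma letter_type_cong:
  assumes "set w = set w'" "c \<in> set w"
    "\<And>c d. c \<in> set w \<Longrightarrow> d \<in> set w \<Longrightarrow> d \<noteq> c \<Longrightarrow> interlaced w c d = interlaced w' c d"
  shows "letter_type w c = letter_type w' c"
proof -
  have ev: "even_in w d = even_in w' d" if "d \<in> set w" for d
    by (rule arg_cong[of _ _ even], rule linking_number_cong) (use assms that in auto)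
  have "linking_number w (\<lambda>d. \<not> even_in w d) c = linking_number w' (\<lambda>d. \<not> even_in w' d) c"
    by (rule linking_number_cong) (use assms ev in auto)
  then show ?thesis using ev[OF assms(2)] by (simp add: letter_type_def)
qed

text \<open>Moving the first entry to the end either leaves the restricted word alone or rotates it,
  which exchanges the two alternating patterns.\<close>

lemma interlaced_rotate1:
  assumes "c \<noteq> d"
  shows "interlaced (rotate1 w) c d \<longleftrightarrow> interlaced w c d"
proof (cases w)
  case (Cons x v)
  have "v' @ [c] = [d, c, d, c] \<longleftrightarrow> v' = [d, c, d]" "v' @ [d] = [c, d, c, d] \<longleftrightarrow> v' = [c, d, c]"
    for v' by auto
  then show ?thesis using assms by (auto simp: interlaced_def Cons)
qed simp

lemma type_word_rotate1: "type_word (rotate1 w) = rotate1 (type_word w)"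
proof -
  have "letter_type (rotate1 w) c = letter_type w c" if "c \<in> set w" for c
    by (rule letter_type_cong) (use that in \<open>auto simp: interlaced_rotate1\<close>)
  then show ?thesis by (simp add: type_word_def rotate1_map)
qed

lemma type_word_rotate: "type_word (rotate n w) = rotate n (type_word w)"
  by (induction n) (simp_all add: type_word_rotate1)

lemma conjugate_in_G_type_word_rotation:
  "conjugate_in G (G_element (type_word (u @ v))) (G_element (type_word (v @ u)))"
proof -
  obtain a b where ab: "type_word (u @ v) = a @ b" "length a = length u"
    by (simp add: type_word_def)
  have "type_word (v @ u) = rotate (length a) (a @ b)"
    using type_word_rotate[of "length u" "u @ v"] ab by (simp add: rotate_append)
  then have "type_word (v @ u) = b @ a" by (simp add: rotate_append)
  then show ?thesis by (simp add: ab conjugate_in_G_rotation)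
qed

lemma interlaced_map:
  assumes "inj_on f (set w)" "c \<in> set w" "d \<in> set w"
  shows "interlaced (map f w) (f c) (f d) \<longleftrightarrow> interlaced w c d"
proof -
  let ?v = "filter (\<lambda>x. x = c \<or> x = d) w"
  have "filter (\<lambda>x. x = f c \<or> x = f d) (map f w) = map f ?v"
    using assms by (auto simp: filter_map inj_on_def intro!: arg_cong[of _ _ "map f"] filter_cong)
  moreover have "map f ?v = map f l \<longleftrightarrow> ?v = l" if "set l \<subseteq> set w" for l
    by (rule inj_on_map_eq_map, rule inj_on_subset[OF assms(1)]) (use that in auto)
  from this[of "[c, d, c, d]"] this[of "[d, c, d, c]"] assms(2,3)
  have "map f ?v = [f c, f d, f c, f d] \<longleftrightarrow> ?v = [c, d, c, d]"
    "map f ?v = [f d, f c, f d, f c] \<longleftrightarrow> ?v = [d, c, d, c]" by simp_all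
  ultimately show ?thesis by (simp add: interlaced_def)
qed

text \<open>Used for homeomorphisms and for the switch of ends in the third move: both replace every
  chord by its image.\<close>

lemma type_word_map:
  assumes "inj_on f (set w)"
  shows "type_word (map f w) = type_word w"
proof -
  have lk: "linking_number (map f w) P (f c) = linking_number w P' c"
    if "c \<in> set w" "\<And>d. d \<in> set w \<Longrightarrow> P (f d) = P' d" for P P' c
  proof -
    have "set (map f w) - {f c} = f ` (set w - {c})" "inj_on f (set w - {c})"
      using assms that(1) by (auto simp: inj_on_def)
    then show ?thesis
      unfolding linking_number_def using that
      by (simp add: sum.reindex interlaced_map[OF assms] del: sum_of_bool_eq)
  qed
  have "letter_type (map f w) (f c) = letter_type w c" if "c \<in> set w" for c
    using that by (simp add: letter_type_def lk[of _ _ "\<lambda>_. True"] lk[of _ _ "\<lambda>d. \<not> even_in w d"])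
  then show ?thesis by (simp add: type_word_def)
qed

section \<open>Effect of the three moves on words\<close>

text \<open>Nothing stands between the two occurrences of \<open>p\<close>, so \<open>p\<close> is
  interlaced with no other letter: it is even, contributes the square of \<open>La\<close>, and
  affects no other count.\<close>

lemma type_word_kink:
  assumes "p \<notin> set u"
  shows "G_element (type_word (u @ [p, p])) = G_element (type_word u)"
proof -
  let ?w = "u @ [p, p]"
  have old: "interlaced ?w c d = interlaced u c d" if "c \<in> set u" "d \<in> set u" for c d
    using that assms by (auto simp: interlaced_def)
  have p: "\<not> interlaced ?w p c" if "c \<in> set u" for c
    using interlaced_iff_count_list[of p u "[]" "[]" c] that assms by auto
  have S: "set ?w - {c} = insert p (set u - {c})" if "c \<in> set u" for c
    using that assms by auto
  have lk: "linking_number ?w P c = linking_number u P' c"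
    if "c \<in> set u" "\<And>d. d \<in> set u \<Longrightarrow> P d = P' d" for P P' c
    unfolding linking_number_def S[OF that(1)] using that assms p[OF that(1)] old
    by (auto simp: interlaced_commute[of _ c p] simp del: sum_of_bool_eq intro!: sum.cong)
  have "letter_type ?w c = letter_type u c" if "c \<in> set u" for c
    using that by (simp add: letter_type_def lk[of _ _ "\<lambda>_. True"] lk[of _ _ "\<lambda>d. \<not> even_in u d"])
  moreover have "linking_number ?w (\<lambda>_. True) p = 0"
    using assms p by (auto simp: linking_number_def)
  ultimately have "type_word ?w = type_word u @ [La, La] @ []"
    by (simp add: type_word_def letter_type_def)
  then show ?thesis by (simp only: G_element_cancel) simp
qed

text \<open>The letters \<open>p\<close> and \<open>q\<close> are interlaced with the same outside
  letters. Hence they have equal type, and together they change the count of an outside letter by an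
  even number; each of \<open>s\<close> and \<open>s'\<close> contributes a square. Depending on the
  orders in \<open>s\<close> and \<open>s'\<close>, \<open>p\<close> and \<open>q\<close> may or may
  not be interlaced with each other.\<close>

lemma type_word_bigon:
  assumes "p \<noteq> q" "p \<notin> set u \<union> set v" "q \<notin> set u \<union> set v"
    and s: "s = [p, q] \<or> s = [q, p]" and s': "s' = [p, q] \<or> s' = [q, p]"
  shows "G_element (type_word (u @ s @ v @ s')) = G_element (type_word (u @ v))"
proof -
  let ?w = "u @ s @ v @ s'" and ?S = "set u \<union> set v"
  have old: "interlaced ?w c d = interlaced (u @ v) c d" if "c \<in> ?S" "d \<in> ?S" for c d
  proof -
    have "c \<noteq> p" "c \<noteq> q" "d \<noteq> p" "d \<noteq> q" using that assms(2,3) by auto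
    then have "filter (\<lambda>x. x = c \<or> x = d) ?w = filter (\<lambda>x. x = c \<or> x = d) (u @ v)"
      using s s' by auto
    then show ?thesis by (simp only: interlaced_def)
  qed
  have pq: "interlaced ?w p c \<longleftrightarrow> interlaced ?w q c" if "c \<in> ?S" for c
  proof -
    have "c \<noteq> p" "c \<noteq> q" using that assms by auto
    then have "interlaced ?w p c \<longleftrightarrow> count_list v c = 1 \<and> count_list u c = 1"
      using s s' assms(1-3) interlaced_iff_count_list[of p u "q # v" "[q]" c]
        interlaced_iff_count_list[of p "u" "q # v @ [q]" "[]" c]
        interlaced_iff_count_list[of p "u @ [q]" "v" "[q]" c]
        interlaced_iff_count_list[of p "u @ [q]" "v @ [q]" "[]" c] by auto
    moreover have "interlaced ?w q c \<longleftrightarrow> count_list v c = 1 \<and> count_list u c = 1"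
      using \<open>c \<noteq> p\<close> \<open>c \<noteq> q\<close> s s' assms(1-3) interlaced_iff_count_list[of q u "p # v" "[p]" c]
        interlaced_iff_count_list[of q "u" "p # v @ [p]" "[]" c]
        interlaced_iff_count_list[of q "u @ [p]" "v" "[p]" c]
        interlaced_iff_count_list[of q "u @ [p]" "v @ [p]" "[]" c] by auto
    ultimately show ?thesis by simp
  qed
  have set_w: "set ?w = insert p (insert q ?S)" using s s' by auto
  \<comment> \<open>With \<open>P p = P q\<close> the contributions of \<open>p\<close> and
    \<open>q\<close> coincide and drop out modulo 2. Both predicates in use satisfy this, since
    \<open>p\<close> and \<open>q\<close> have the same parity.\<close>
  have lk: "even (linking_number ?w P c) = even (linking_number (u @ v) P' c)"
    if c: "c \<in> ?S" and "\<And>d. d \<in> ?S \<Longrightarrow> P d = P' d" and "P p = P q" for P P' c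
  proof -
    have "set ?w - {c} = insert p (insert q (?S - {c}))" using c assms set_w by auto
    then have "linking_number ?w P c = of_bool (interlaced ?w c p \<and> P p) +
      (of_bool (interlaced ?w c q \<and> P q) + (\<Sum>d\<in>?S - {c}. of_bool (interlaced ?w c d \<and> P d)))"
      unfolding linking_number_def using assms(1-3) by (simp del: sum_of_bool_eq)
    moreover have "interlaced ?w c p = interlaced ?w c q"
      using pq[OF c] by (simp add: interlaced_commute[of _ c])
    moreover have "(\<Sum>d\<in>?S - {c}. of_bool (interlaced ?w c d \<and> P d)) = linking_number (u @ v) P' c"
      unfolding linking_number_def using that old by (auto simp del: sum_of_bool_eq intro!: sum.cong)
    ultimately show ?thesis using that(3) by simp
  qed
  \<comment> \<open>Besides the outside letters, \<open>p\<close> counts \<open>q\<close> and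
    \<open>q\<close> counts \<open>p\<close>, which is symmetric once
    \<open>P p = P q\<close>.\<close>
  have lk_pq: "linking_number ?w P p = linking_number ?w P q" if "P p = P q" for P
  proof -
    have "set ?w - {p} = insert q ?S" "set ?w - {q} = insert p ?S" using assms(1-3) set_w by auto
    then show ?thesis
      unfolding linking_number_def using assms(1-3) pq that
      by (simp add: interlaced_commute[of _ q p] del: sum_of_bool_eq)
  qed
  have ev: "even_in ?w d = even_in (u @ v) d" if "d \<in> ?S" for d
    by (rule lk) (use that in auto)
  have ev_pq: "even_in ?w p = even_in ?w q" using lk_pq[of "\<lambda>_. True"] by simp
  have pq_type: "letter_type ?w p = letter_type ?w q"
    using lk_pq[of "\<lambda>d. \<not> even_in ?w d"] ev_pq by (simp add: letter_type_def)
  have "letter_type ?w c = letter_type (u @ v) c" if "c \<in> ?S" for c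
    unfolding letter_type_def
    using ev[OF that] lk[of c "\<lambda>d. \<not> even_in ?w d" "\<lambda>d. \<not> even_in (u @ v) d", OF that] ev ev_pq by auto
  then have "map (letter_type ?w) u = map (letter_type (u @ v)) u"
    "map (letter_type ?w) v = map (letter_type (u @ v)) v" by auto
  moreover have "map (letter_type ?w) s = [letter_type ?w p, letter_type ?w p]"
    "map (letter_type ?w) s' = [letter_type ?w p, letter_type ?w p]"
    using s s' pq_type by auto
  ultimately have "type_word ?w = map (letter_type (u @ v)) u @ [letter_type ?w p, letter_type ?w p] @
      map (letter_type (u @ v)) v @ [letter_type ?w p, letter_type ?w p]"
    unfolding type_word_def map_append by (simp only:)
  then have "G_element (type_word ?w) = G_element
      ((map (letter_type (u @ v)) u @ map (letter_type (u @ v)) v) @ [letter_type ?w p, letter_type ?w p] @ [])"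
    by (simp only: G_element_cancel append_assoc append_Nil2)
  then show ?thesis by (simp only: G_element_cancel) (simp add: type_word_def)
qed

text \<open>The hypotheses say that priming fixes \<open>La\<close> and exchanges \<open>Lb\<close>
  with \<open>Lb'\<close>. Pairs with one \<open>La\<close> are the two commutation rules, pairs of
  equal letters are trivial in \<open>G\<close>, and for the pairs of \<open>Lb\<close> and
  \<open>Lb'\<close> the right-hand word is literally the left-hand one.\<close>

lemma G_element_toggle:
  assumes "x = La \<longleftrightarrow> x' = La" "y = La \<longleftrightarrow> y' = La" "x = x' \<longleftrightarrow> x = La" "y = y' \<longleftrightarrow> y = La"
  shows "G_element [x, y] = G_element [y', x']"
  using assms G_element_a_b G_element_b_a
  by (cases x; cases y; cases x'; cases y'; simp add: G_element_square)

text \<open>Why odd letters change type: for odd \<open>c\<close> among the three, exactly one of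
  the other two is odd. Both links of \<open>c\<close> toggle, so its number of odd neighbours
  changes parity. The degree of each of the three keeps its parity, as two links toggle.\<close>

lemma type_word_triangle:
  assumes distinct: "distinct [p, q, r]"
    and twice: "\<And>c. c \<in> set (u @ s1 @ v @ s2 @ t @ s3) \<Longrightarrow> count_list (u @ s1 @ v @ s2 @ t @ s3) c = 2"
    and s1: "s1 = [p, q] \<or> s1 = [q, p]" and s2: "s2 = [q, r] \<or> s2 = [r, q]"
    and s3: "s3 = [p, r] \<or> s3 = [r, p]"
  shows "G_element (type_word (u @ s1 @ v @ s2 @ t @ s3)) =
    G_element (type_word (u @ rev s1 @ v @ rev s2 @ t @ rev s3))"
proof -
  let ?w = "u @ s1 @ v @ s2 @ t @ s3" and ?w' = "u @ rev s1 @ v @ rev s2 @ t @ rev s3"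
  let ?S = "set u \<union> set v \<union> set t" and ?T = "{p, q, r}"
  have set_w: "set ?w = ?T \<union> ?S" "set ?w' = ?T \<union> ?S" using s1 s2 s3 by auto
  have pqr [simp]: "p \<noteq> q" "q \<noteq> p" "p \<noteq> r" "r \<noteq> p" "q \<noteq> r" "r \<noteq> q" using distinct by auto
  have notin: "?T \<inter> ?S = {}"
  proof -
    have "count_list u c + count_list v c + count_list t c = 0" if "c \<in> ?T" for c
      using twice[of c] that s1 s2 s3 by auto
    then show ?thesis by (auto simp flip: count_list_0_iff)
  qed
  have flt: "filter (\<lambda>x. x = c \<or> x = d) l = []"
    if "c \<in> ?T" "d \<in> ?T" "l = u \<or> l = v \<or> l = t" for c d l
    using that notin by (auto simp: filter_empty_conv)
  \<comment> \<open>Only \<open>s1\<close> contains both \<open>p\<close> and \<open>q\<close>,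
    while \<open>s2\<close> and \<open>s3\<close> contain one each. Reversing all three blocks
    therefore exchanges just one pair of neighbours in the restricted word.\<close>
  have toggle_pq: "interlaced ?w' p q \<longleftrightarrow> \<not> interlaced ?w p q"
    using s1 s2 s3 flt[of p q] unfolding interlaced_def by (elim disjE) simp_all
  have toggle_pr: "interlaced ?w' p r \<longleftrightarrow> \<not> interlaced ?w p r"
    using s1 s2 s3 flt[of p r] unfolding interlaced_def by (elim disjE) simp_all
  have toggle_qr: "interlaced ?w' q r \<longleftrightarrow> \<not> interlaced ?w q r"
    using s1 s2 s3 flt[of q r] unfolding interlaced_def by (elim disjE) simp_all
  have toggle: "interlaced ?w' c d \<longleftrightarrow> \<not> interlaced ?w c d" if "c \<in> ?T" "d \<in> ?T" "c \<noteq> d" for c d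
    using that toggle_pq toggle_pr toggle_qr by (auto simp: interlaced_commute)
  have flt2: "filter (\<lambda>x. x = c \<or> x = d) (rev l) = filter (\<lambda>x. x = c \<or> x = d) l"
    if "c \<in> ?S \<or> d \<in> ?S" "l = s1 \<or> l = s2 \<or> l = s3" for c d l
    using that notin s1 s2 s3 by auto
  have old: "interlaced ?w' c d = interlaced ?w c d" if "c \<in> ?S \<or> d \<in> ?S" for c d
    using that unfolding interlaced_def by (simp add: flt2 del: rev.simps)
  \<comment> \<open>The occurrences of \<open>p\<close> lie in \<open>s1\<close> and
    \<open>s3\<close>, those of \<open>q\<close> in \<open>s1\<close> and \<open>s2\<close>, those
    of \<open>r\<close> in \<open>s2\<close> and \<open>s3\<close>; this decides which of
    \<open>v\<close> and \<open>t\<close> they enclose. As \<open>d\<close> occurs twice in all, one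
    occurrence inside is the same as an odd number inside.\<close>
  have odds: "interlaced ?w p d \<longleftrightarrow> odd (count_list v d + count_list t d)"
     "interlaced ?w q d \<longleftrightarrow> odd (count_list v d)"
     "interlaced ?w r d \<longleftrightarrow> odd (count_list t d)" if d: "d \<in> ?S" for d
  proof -
    have d': "d \<noteq> p" "d \<noteq> q" "d \<noteq> r" using notin d by auto
    have two: "count_list u d + count_list v d + count_list t d = 2"
      using twice[of d] d d' s1 s2 s3 by auto
    show "interlaced ?w p d \<longleftrightarrow> odd (count_list v d + count_list t d)"
    proof -
      have "interlaced ?w p d \<longleftrightarrow> count_list v d + count_list t d = 1 \<and> count_list u d = 1"
        using s1 s2 s3 notin d'
          interlaced_iff_count_list[of p u "q # v @ s2 @ t" "[r]" d]
          interlaced_iff_count_list[of p u "q # v @ s2 @ t @ [r]" "[]" d]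
          interlaced_iff_count_list[of p "u @ [q]" "v @ s2 @ t" "[r]" d]
          interlaced_iff_count_list[of p "u @ [q]" "v @ s2 @ t @ [r]" "[]" d] by (elim disjE) simp_all
      then show ?thesis using two by presburger
    qed
    show "interlaced ?w q d \<longleftrightarrow> odd (count_list v d)"
    proof -
      have "interlaced ?w q d \<longleftrightarrow> count_list v d = 1 \<and> count_list u d + count_list t d = 1"
        using s1 s2 s3 notin d'
          interlaced_iff_count_list[of q u "p # v" "r # t @ s3" d]
          interlaced_iff_count_list[of q u "p # v @ [r]" "t @ s3" d]
          interlaced_iff_count_list[of q "u @ [p]" "v" "r # t @ s3" d]
          interlaced_iff_count_list[of q "u @ [p]" "v @ [r]" "t @ s3" d] by (elim disjE) simp_all
      then show ?thesis using two by presburger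
    qed
    show "interlaced ?w r d \<longleftrightarrow> odd (count_list t d)"
    proof -
      have "interlaced ?w r d \<longleftrightarrow> count_list t d = 1 \<and> count_list u d + count_list v d = 1"
        using s1 s2 s3 notin d'
          interlaced_iff_count_list[of r "u @ s1 @ v @ [q]" "t" "[p]" d]
          interlaced_iff_count_list[of r "u @ s1 @ v @ [q]" "t @ [p]" "[]" d]
          interlaced_iff_count_list[of r "u @ s1 @ v" "q # t" "[p]" d]
          interlaced_iff_count_list[of r "u @ s1 @ v" "q # t @ [p]" "[]" d] by (elim disjE) simp_all
      then show ?thesis using two by presburger
    qed
  qed
  have lkT: "linking_number x P c = of_bool (interlaced x c d \<and> P d) +
      (of_bool (interlaced x c e \<and> P e) + (\<Sum>f\<in>?S. of_bool (interlaced x c f \<and> P f)))"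
    if "set x = ?T \<union> ?S" "distinct [c, d, e]" "?T = {c, d, e}" for x P c d e
  proof -
    have "set x - {c} = insert d (insert e ?S)" "d \<notin> insert e ?S" "e \<notin> ?S"
      using that notin by auto
    then show ?thesis unfolding linking_number_def by (simp del: sum_of_bool_eq)
  qed
  \<comment> \<open>Each of the two flipped links changes the count by one if its other end
    satisfies \<open>P\<close>, so the parity survives exactly if \<open>P d\<close> and
    \<open>P e\<close> agree.\<close>
  have lk_toggle: "even (linking_number ?w' P c) \<longleftrightarrow> (even (linking_number ?w P c) \<longleftrightarrow> (P d \<longleftrightarrow> P e))"
    if "distinct [c, d, e]" "?T = {c, d, e}" for P c d e
  proof -
    have "(\<Sum>f\<in>?S. of_bool (interlaced ?w' c f \<and> P f)) = (\<Sum>f\<in>?S. of_bool (interlaced ?w c f \<and> P f) :: nat)"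
      using old by (intro sum.cong) auto
    moreover have "interlaced ?w' c d \<longleftrightarrow> \<not> interlaced ?w c d" "interlaced ?w' c e \<longleftrightarrow> \<not> interlaced ?w c e"
      by (rule toggle; use that in auto)+
    ultimately show ?thesis
      unfolding lkT[OF set_w(1) that] lkT[OF set_w(2) that] by (auto simp del: sum_of_bool_eq)
  qed
  have ev: "even_in ?w' c = even_in ?w c" if "c \<in> set ?w" for c
  proof (cases "c \<in> ?S")
    case True
    then have "linking_number ?w' (\<lambda>_. True) c = linking_number ?w (\<lambda>_. True) c"
      by (intro linking_number_cong) (use set_w old in auto)
    then show ?thesis by simp
  next
    case False
    then have "c = p \<or> c = q \<or> c = r" using that set_w by auto
    then show ?thesis
      using lk_toggle[of p q r "\<lambda>_. True"] lk_toggle[of q p r "\<lambda>_. True"] lk_toggle[of r q p "\<lambda>_. True"]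
      by (auto simp: insert_commute)
  qed
  \<comment> \<open>By \<open>odds\<close> an outside letter adds an even number to the three
    degrees, and each link inside the triangle is counted twice, so the sum of the degrees is
    even.\<close>
  have odd_number: "even_in ?w p \<longleftrightarrow> (even_in ?w q \<longleftrightarrow> even_in ?w r)"
  proof -
    let ?D = "\<lambda>c. \<Sum>f\<in>?S. of_bool (interlaced ?w c f) :: nat"
    have "even (\<Sum>f\<in>?S. of_bool (interlaced ?w p f) + of_bool (interlaced ?w q f) + of_bool (interlaced ?w r f) :: nat)"
      by (rule dvd_sum) (simp add: odds)
    then have "even (?D p + ?D q + ?D r)" by (simp only: sum.distrib)
    moreover have "linking_number ?w (\<lambda>_. True) p = of_bool (interlaced ?w p q) + (of_bool (interlaced ?w p r) + ?D p)"
      using lkT[OF set_w(1), of p q r "\<lambda>_. True"] by (simp del: sum_of_bool_eq)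
    moreover have "linking_number ?w (\<lambda>_. True) q = of_bool (interlaced ?w p q) + (of_bool (interlaced ?w q r) + ?D q)"
      using lkT[OF set_w(1), of q p r "\<lambda>_. True"]
      by (simp add: interlaced_commute[of _ q p] insert_commute del: sum_of_bool_eq)
    moreover have "linking_number ?w (\<lambda>_. True) r = of_bool (interlaced ?w p r) + (of_bool (interlaced ?w q r) + ?D r)"
      using lkT[OF set_w(1), of r p q "\<lambda>_. True"]
      by (simp add: interlaced_commute[of _ r] insert_commute del: sum_of_bool_eq)
    ultimately show ?thesis by (auto simp del: sum_of_bool_eq)
  qed
  have lk_odd: "linking_number ?w' (\<lambda>d. \<not> even_in ?w' d) c = linking_number ?w' (\<lambda>d. \<not> even_in ?w d) c" for c
    by (rule linking_number_cong) (use ev set_w in auto)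
  have same: "letter_type ?w' c = letter_type ?w c" if "c \<in> ?S" for c
  proof -
    have "linking_number ?w' (\<lambda>d. \<not> even_in ?w d) c = linking_number ?w (\<lambda>d. \<not> even_in ?w d) c"
      by (rule linking_number_cong) (use that set_w old in auto)
    moreover have "even_in ?w' c = even_in ?w c" by (rule ev) (use that in auto)
    ultimately show ?thesis by (simp only: letter_type_def lk_odd)
  qed
  have change: "(letter_type ?w c = La \<longleftrightarrow> letter_type ?w' c = La) \<and>
      (letter_type ?w c = letter_type ?w' c \<longleftrightarrow> letter_type ?w c = La)" if "c \<in> ?T" for c
  proof -
    obtain d e where de: "distinct [c, d, e]" "?T = {c, d, e}"
      and ev_c: "even_in ?w c \<longleftrightarrow> (even_in ?w d \<longleftrightarrow> even_in ?w e)"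
    proof -
      from \<open>c \<in> ?T\<close> consider "c = p" | "c = q" | "c = r" by auto
      then show ?thesis using that
      proof cases
        case 1 then show ?thesis using that[of q r] odd_number by simp
      next
        case 2 then show ?thesis using that[of p r] odd_number by auto
      next
        case 3 then show ?thesis using that[of p q] odd_number by auto
      qed
    qed
    have "even_in ?w' c = even_in ?w c" by (rule ev) (use \<open>c \<in> ?T\<close> set_w in auto)
    moreover have "even (linking_number ?w' (\<lambda>d. \<not> even_in ?w' d) c) \<longleftrightarrow>
        (even (linking_number ?w (\<lambda>d. \<not> even_in ?w d) c) \<longleftrightarrow> even_in ?w c)"
      using lk_toggle[OF de, of "\<lambda>d. \<not> even_in ?w d"] ev_c unfolding lk_odd by argo
    ultimately show ?thesis by (auto simp: letter_type_def)
  qed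
  have pair: "G_element (map (letter_type ?w) [c, d]) = G_element (map (letter_type ?w') (rev [c, d]))"
    if "c \<in> ?T" "d \<in> ?T" for c d
    using change[OF that(1)] change[OF that(2)] by (simp add: G_element_toggle)
  have "G_element (map (letter_type ?w) s) = G_element (map (letter_type ?w') (rev s))"
    if "s = s1 \<or> s = s2 \<or> s = s3" for s
    using that s1 s2 s3 pair by (elim disjE) (simp_all only: insert_iff simp_thms)
  moreover have "map (letter_type ?w) l = map (letter_type ?w') l" if "l = u \<or> l = v \<or> l = t" for l
    using that same by auto
  ultimately show ?thesis
    unfolding type_word_def map_append G_element_append by (simp only: simp_thms)
qed

section \<open>Angles on the circle\<close>

lemma cis_eq_iff_near:
  assumes "\<bar>a - b\<bar> < 2 * pi"
  shows "cis a = cis b \<longleftrightarrow> a = b"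
proof
  assume "cis a = cis b"
  then have "sin a = sin b \<and> cos a = cos b" by (simp add: complex_eq_iff)
  then obtain n where "a = b + 2 * pi * real_of_int n" by (auto simp: sin_cos_eq_iff)
  moreover from this assms have "\<bar>2 * pi * real_of_int n\<bar> < 2 * pi * 1" by simp
  then have "\<bar>real_of_int n\<bar> < 1" by (simp add: abs_mult)
  ultimately show "a = b" by simp
qed simp

lemma cis_add_2pi: "cis (t + 2 * pi) = cis t"
  by (simp flip: cis_mult)

lemma circle_eq_iff_near:
  assumes "X \<in> circle" "\<bar>a - b\<bar> < 2 * pi"
  shows "X * cis a = X * cis b \<longleftrightarrow> a = b"
  using assms cis_eq_iff_near by auto

lemma circle_angle_cases:
  assumes "X \<in> circle" "z \<in> circle"
  obtains t where "0 \<le> t" "t < 2 * pi" "z = X * cis t"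
proof -
  have "norm (z / X) = 1" using assms by (simp add: norm_divide)
  then have "z / X = cis (Arg2pi (z / X))"
    using Arg2pi_eq[of "z / X"] by (simp add: cis_conv_exp mult.commute)
  then show ?thesis
    using that[of "Arg2pi (z / X)"] assms Arg2pi[of "z / X"]
    by (metis Arg2pi_ge_0 Arg2pi_lt_2pi dist_0_norm mem_sphere nonzero_mult_div_cancel_left norm_zero times_divide_eq_right zero_neq_one)
qed

text \<open>The left side is the cross product of the chord vector with the vector to a third point,
  whose sign tells the side of the line through the chord ends. The product of half-angle sines
  makes this sign readable from the angles.\<close>

lemma chord_side:
  assumes "X \<in> circle"
  shows "Im ((X * cis t - X * cis a) * cnj (X * cis b - X * cis a)) =
    4 * sin ((t - a) / 2) * sin ((t - b) / 2) * sin ((b - a) / 2)"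
proof -
  have X: "X * cnj X = 1" using assms by (simp add: complex_norm_square[symmetric])
  have "(X * cis t - X * cis a) * cnj (X * cis b - X * cis a) =
      (X * cnj X) * ((cis t - cis a) * (cis (- b) - cis (- a)))"
    by (simp add: cis_cnj algebra_simps)
  from this[unfolded X mult_1_left]
  have "Im ((X * cis t - X * cis a) * cnj (X * cis b - X * cis a)) =
      sin (t - b) - sin (t - a) + sin (b - a)"
    by (simp only:) (simp add: sin_diff algebra_simps)
  also have "\<dots> = 4 * sin ((t - a) / 2) * sin ((t - b) / 2) * sin ((b - a) / 2)"
  proof -
    define x y where "x = (t - a) / 2" and "y = (t - b) / 2"
    have e: "t - a = 2 * x" "t - b = 2 * y" "b - a = 2 * (x - y)" "(b - a) / 2 = x - y"
      "(t - a) / 2 = x" "(t - b) / 2 = y"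
      by (simp_all add: x_def y_def field_simps)
    have c: "cos x * cos x = 1 - sin x * sin x" "cos y * cos y = 1 - sin y * sin y"
      by (simp_all flip: power2_eq_square add: cos_squared_eq)
    have "sin (2 * y) - sin (2 * x) + sin (2 * (x - y)) = 4 * sin x * sin y * sin (x - y)"
      unfolding sin_double[of "x - y"] sin_double[of x] sin_double[of y] sin_diff cos_diff
      using c by algebra
    moreover have "2 * z / 2 = z" for z :: real by simp
    ultimately show ?thesis unfolding e by (simp only:)
  qed
  finally show ?thesis .
qed

text \<open>Removing the ends of a chord leaves two arcs. Each is connected as the image of an
  interval of angles, and the line through the ends separates them: \<open>?L\<close> has no zero on
  the remaining circle and opposite signs on the two arcs.\<close>

lemma linked_iff_angles:
  assumes X: "X \<in> circle" and ab: "0 < a" "a < b" "b < 2 * pi"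
    and st: "0 < s" "s < 2 * pi" "0 < t" "t < 2 * pi" and ne: "s \<notin> {a, b}" "t \<notin> {a, b}"
  shows "linked {X * cis s, X * cis t} {X * cis a, X * cis b} \<longleftrightarrow>
    (s \<in> {a<..<b}) \<noteq> (t \<in> {a<..<b})"
proof -
  let ?q = "{X * cis a, X * cis b}" and ?S = "circle - {X * cis a, X * cis b}"
  let ?L = "\<lambda>z. Im ((z - X * cis a) * cnj (X * cis b - X * cis a))"
  have inS: "X * cis u \<in> ?S" if "0 < u" "u < 2 * pi" "u \<notin> {a, b}" for u
    using that X ab circle_eq_iff_near[OF X, of u a] circle_eq_iff_near[OF X, of u b]
    by (auto simp: norm_mult)
  have img: "(\<lambda>u. X * cis u) ` {a<..<b} \<subseteq> ?S"
    by (rule image_subsetI, rule inS) (use ab in auto)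
  \<comment> \<open>The second arc passes through \<open>X\<close>, at angle \<open>2 * pi\<close>,
    so its angles run beyond the full turn.\<close>
  have img': "(\<lambda>u. X * cis u) ` {b<..<a + 2 * pi} \<subseteq> ?S"
    using X ab circle_eq_iff_near[OF X, of _ "a + 2 * pi"] circle_eq_iff_near[OF X, of _ b]
    by (auto simp: cis_add_2pi norm_mult)
  have con: "connected ((\<lambda>u. X * cis u) ` {u<..<v})" for u v
    by (intro connected_continuous_image continuous_intros) auto
  have conn: "connected_component ?S (X * cis s) (X * cis t)"
    if "s \<in> {a<..<b} \<longleftrightarrow> t \<in> {a<..<b}"
  proof (cases "s \<in> {a<..<b}")
    case True
    then show ?thesis using that img con unfolding connected_component_def by blast
  next
    case False
    have mem: "X * cis u \<in> (\<lambda>u. X * cis u) ` {b<..<a + 2 * pi}"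
      if "u \<notin> {a<..<b}" "0 < u" "u < 2 * pi" "u \<notin> {a, b}" for u
    proof (cases "u < a")
      case True
      then show ?thesis using that ab by (auto intro!: image_eqI[of _ _ "u + 2 * pi"] simp: cis_add_2pi)
    qed (use that ab in auto)
    have "X * cis s \<in> (\<lambda>u. X * cis u) ` {b<..<a + 2 * pi}" "X * cis t \<in> (\<lambda>u. X * cis u) ` {b<..<a + 2 * pi}"
      using mem[of s] mem[of t] False that st ne by blast+
    then show ?thesis
      unfolding connected_component_def using img' con[of b "a + 2 * pi"] by (intro exI conjI)
  qed
  have sgn: "?L (X * cis u) < 0 \<longleftrightarrow> u \<in> {a<..<b}" "?L (X * cis u) \<noteq> 0"
    if "0 < u" "u < 2 * pi" "u \<notin> {a, b}" for u
  proof -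
    have half: "sin ((u - v) / 2) > 0 \<longleftrightarrow> u > v" "sin ((u - v) / 2) < 0 \<longleftrightarrow> u < v" "sin ((u - v) / 2) = 0 \<longleftrightarrow> u = v"
      if "\<bar>u - v\<bar> < 2 * pi" for u v
    proof -
      consider "u > v" | "u < v" | "u = v" by linarith
      then have "(u > v \<and> sin ((u - v) / 2) > 0) \<or> (u < v \<and> sin ((u - v) / 2) < 0) \<or> u = v"
      proof cases
        case 1
        then show ?thesis using that sin_gt_zero[of "(u - v) / 2"] by auto
      next
        case 2
        moreover have "sin ((u - v) / 2) = - sin ((v - u) / 2)" by (metis minus_diff_eq minus_divide_left sin_minus)
        ultimately show ?thesis using that sin_gt_zero[of "(v - u) / 2"] by auto
      qed simp
      then show "sin ((u - v) / 2) > 0 \<longleftrightarrow> u > v" "sin ((u - v) / 2) < 0 \<longleftrightarrow> u < v" "sin ((u - v) / 2) = 0 \<longleftrightarrow> u = v"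
        by auto
    qed
    have bd: "\<bar>u - a\<bar> < 2 * pi" "\<bar>u - b\<bar> < 2 * pi" "\<bar>b - a\<bar> < 2 * pi" using that ab by auto
    show "?L (X * cis u) < 0 \<longleftrightarrow> u \<in> {a<..<b}" "?L (X * cis u) \<noteq> 0"
      unfolding chord_side[OF X] using that ab half[OF bd(1)] half[OF bd(2)] half[OF bd(3)]
      by (auto simp: mult_less_0_iff zero_less_mult_iff)
  qed
  have Lnz: "?L z \<noteq> 0" if z: "z \<in> ?S" for z
  proof -
    obtain u where u: "0 \<le> u" "u < 2 * pi" "z = X * cis u"
      using circle_angle_cases[OF X, of z] z by blast
    show ?thesis
    proof (cases "u = 0")
      case True
      \<comment> \<open>Angle 0 is outside the range of \<open>sgn\<close>, so \<open>X\<close> is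
        evaluated at \<open>2 * pi\<close>, where all three half-angle sines are positive.\<close>
      have "?L (X * cis (0 + 2 * pi)) = 4 * sin (pi - a / 2) * sin (pi - b / 2) * sin ((b - a) / 2)"
        unfolding chord_side[OF X] by (simp add: diff_divide_distrib)
      moreover have "sin (a / 2) > 0" "sin (b / 2) > 0" "sin ((b - a) / 2) > 0"
        by (rule sin_gt_zero; use ab in simp)+
      ultimately show ?thesis using u True by (simp add: cis_add_2pi)
    qed (use u z sgn(2)[of u] in auto)
  qed
  have disc: "\<not> connected_component ?S (X * cis s) (X * cis t)"
    if "(s \<in> {a<..<b}) \<noteq> (t \<in> {a<..<b})"
  proof
    assume "connected_component ?S (X * cis s) (X * cis t)"
    then obtain T where T: "connected T" "T \<subseteq> ?S" "X * cis s \<in> T" "X * cis t \<in> T"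
      by (auto simp: connected_component_def)
    have con: "connected (?L ` T)" by (intro connected_continuous_image continuous_intros T)
    have mem: "?L (X * cis s) \<in> ?L ` T" "?L (X * cis t) \<in> ?L ` T" using T by blast+
    have "?L (X * cis s) < 0 \<and> 0 < ?L (X * cis t) \<or> ?L (X * cis t) < 0 \<and> 0 < ?L (X * cis s)"
      using that sgn[of s] sgn[of t] st ne by (smt (verit))
    then have "0 \<in> ?L ` T"
      using connectedD_interval[OF con mem, of 0] connectedD_interval[OF con mem(2,1), of 0] less_imp_le by blast
    then show False using Lnz T(2) by force
  qed
  have pt: "X * cis s \<in> ?S" "X * cis t \<in> ?S" using inS st ne by auto
  let ?C = "\<lambda>u. connected_component_set ?S (X * cis u)"
  have "linked {X * cis s, X * cis t} ?q \<longleftrightarrow> \<not> connected_component ?S (X * cis s) (X * cis t)"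
  proof
    assume "linked {X * cis s, X * cis t} ?q"
    then obtain U V x y where UV: "U \<in> components ?S" "V \<in> components ?S" "U \<noteq> V"
      and xy: "x \<in> {s, t}" "X * cis x \<in> U" "y \<in> {s, t}" "X * cis y \<in> V"
      unfolding linked_def by blast
    have *: "W = ?C x" if "W \<in> components ?S" "X * cis x \<in> W" for W x
      using that by (metis componentsE connected_component_eq)
    show "\<not> connected_component ?S (X * cis s) (X * cis t)"
    proof
      assume "connected_component ?S (X * cis s) (X * cis t)"
      then have "?C t = ?C s" by (intro connected_component_eq) simp
      then have "?C x = ?C y" using xy(1,3) by (elim insertE emptyE) simp_all
      then show False using UV(3) *[OF UV(1) xy(2)] *[OF UV(2) xy(4)] by simp
    qed
  next
    assume n: "\<not> connected_component ?S (X * cis s) (X * cis t)"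
    have self: "X * cis s \<in> ?C s" "X * cis t \<in> ?C t" using pt by simp_all
    then have ne: "?C s \<noteq> ?C t" using n by blast
    have comp: "?C s \<in> components ?S" "?C t \<in> components ?S" using pt by (simp_all only: componentsI)
    obtain U V where "U \<in> components ?S" "V \<in> components ?S" "U \<noteq> V" "X * cis s \<in> U" "X * cis t \<in> V"
      by (rule that[OF comp ne self])
    then show "linked {X * cis s, X * cis t} ?q" unfolding linked_def by blast
  qed
  then show ?thesis using conn disc by blast
qed

section \<open>The chord word of a based diagram\<close>

text \<open>This is the Gauss code of the based diagram, with the chords themselves as letters so
  that no labelling has to be chosen.\<close>

definition gauss_word :: "chord set \<Rightarrow> complex \<Rightarrow> chord list" where
  "gauss_word D X = map (\<lambda>\<theta>. chord_at D (X * cis \<theta>)) (meeting_angles D X)"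

lemma chord_diagram_subset: "chord_diagram D \<Longrightarrow> C \<subseteq> D \<Longrightarrow> chord_diagram C"
  by (auto simp: chord_diagram_def intro: finite_subset pairwise_subset)

lemma base_point_subset: "base_point D X \<Longrightarrow> C \<subseteq> D \<Longrightarrow> base_point C X"
  by (auto simp: base_point_def ends_def)

lemma finite_ends: "chord_diagram D \<Longrightarrow> finite (ends D)"
  unfolding chord_diagram_def ends_def by (intro finite_Union) (auto intro: card_ge_0_finite)

lemma ends_subset_circle: "chord_diagram D \<Longrightarrow> ends D \<subseteq> circle"
  unfolding chord_diagram_def ends_def by blast

lemma chord_at_eq:
  assumes "chord_diagram D" "c \<in> D" "z \<in> c"
  shows "chord_at D z = c"
  unfolding chord_at_def
proof (rule the_equality)
  show "d = c" if "d \<in> D \<and> z \<in> d" for d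
    using assms that unfolding chord_diagram_def pairwise_def disjnt_def by blast
qed (use assms in simp)

lemma cis_eq_iff_angle:
  assumes "0 < a" "a < 2 * pi" "0 < t" "t < 2 * pi"
  shows "cis t = cis a \<longleftrightarrow> t = a"
  using cis_eq_iff_near[of t a] assms by auto

lemma finite_end_angles:
  assumes "chord_diagram D" "X \<in> circle"
  shows "finite {\<theta> \<in> {0<..<2 * pi}. X * cis \<theta> \<in> ends D}"
proof (rule finite_imageD)
  show "finite ((\<lambda>\<theta>. X * cis \<theta>) ` {\<theta> \<in> {0<..<2 * pi}. X * cis \<theta> \<in> ends D})"
    by (rule finite_subset[OF _ finite_ends[OF assms(1)]]) auto
  show "inj_on (\<lambda>\<theta>. X * cis \<theta>) {\<theta> \<in> {0<..<2 * pi}. X * cis \<theta> \<in> ends D}"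
    by (rule inj_onI) (use assms(2) in \<open>auto simp: cis_eq_iff_angle\<close>)
qed

lemma meeting_angles:
  assumes "chord_diagram D" "X \<in> circle"
  shows "set (meeting_angles D X) = {\<theta> \<in> {0<..<2 * pi}. X * cis \<theta> \<in> ends D}"
    and "sorted_wrt (<) (meeting_angles D X)"
  using finite_end_angles[OF assms] by (simp_all add: meeting_angles_def)

lemma meeting_angles_eqI:
  assumes "sorted_wrt (<) ts" "set ts = {\<theta> \<in> {0<..<2 * pi}. X * cis \<theta> \<in> ends D}"
  shows "meeting_angles D X = ts"
  unfolding meeting_angles_def assms(2)[symmetric]
  using assms(1) by (simp add: strict_sorted_iff sorted_list_of_set.idem_if_sorted_distinct)

text \<open>Each end lies on one chord only, so passing to a subdiagram just skips the angles of the
  other chords. This serves the removal of chords by moves, and it reduces questions about one or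
  two chords to diagrams consisting of these alone.\<close>

lemma gauss_word_subset:
  assumes D: "chord_diagram D" and X: "base_point D X" and C: "C \<subseteq> D"
  shows "gauss_word C X = filter (\<lambda>c. c \<in> C) (gauss_word D X)"
proof -
  have X': "X \<in> circle" using X by (simp add: base_point_def)
  have mem: "chord_at D z \<in> C \<longleftrightarrow> z \<in> ends C" "z \<in> ends C \<Longrightarrow> chord_at C z = chord_at D z"
    if z: "z \<in> ends D" for z
  proof -
    obtain c where c: "c \<in> D" "z \<in> c" using z by (auto simp: ends_def)
    have eq: "d = c" if "d \<in> D" "z \<in> d" for d
      using chord_at_eq[OF D c] chord_at_eq[OF D that] by simp
    then show "chord_at D z \<in> C \<longleftrightarrow> z \<in> ends C"
      unfolding chord_at_eq[OF D c] ends_def using C c(2) eq by blast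
    show "chord_at C z = chord_at D z" if z: "z \<in> ends C"
    proof -
      obtain d where d: "d \<in> C" "z \<in> d" using z by (auto simp: ends_def)
      show ?thesis
        using chord_at_eq[OF chord_diagram_subset[OF D C] d] chord_at_eq[OF D _ d(2)] C d by auto
    qed
  qed
  have "meeting_angles C X = filter (\<lambda>\<theta>. X * cis \<theta> \<in> ends C) (meeting_angles D X)"
    using C by (intro meeting_angles_eqI sorted_wrt_filter)
      (auto simp: meeting_angles[OF D X'] ends_def)
  then have "gauss_word C X = map (\<lambda>\<theta>. chord_at D (X * cis \<theta>))
      (filter (\<lambda>\<theta>. X * cis \<theta> \<in> ends C) (meeting_angles D X))"
    unfolding gauss_word_def using mem(2) meeting_angles(1)[OF D X'] by (simp add: map_eq_conv)
  also have "\<dots> = filter (\<lambda>c. c \<in> C) (gauss_word D X)"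
    unfolding gauss_word_def filter_map comp_def
    by (intro arg_cong[of _ _ "map _"] filter_cong) (auto simp: meeting_angles(1)[OF D X'] mem)
  finally show ?thesis .
qed

lemma end_angle:
  assumes "chord_diagram D" "base_point D X" "z \<in> ends D"
  obtains t where "0 < t" "t < 2 * pi" "z = X * cis t"
proof -
  obtain t where t: "0 \<le> t" "t < 2 * pi" "z = X * cis t"
    using circle_angle_cases[of X z] assms subsetD[OF ends_subset_circle[OF assms(1)] assms(3)]
    by (auto simp: base_point_def)
  moreover have "t \<noteq> 0" using assms t by (auto simp: base_point_def)
  ultimately show ?thesis using that[of t] by simp
qed

lemma chord_angles:
  assumes "chord_diagram D" "base_point D X" "c \<in> D"
  obtains a b where "0 < a" "a < b" "b < 2 * pi" "c = {X * cis a, X * cis b}"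
proof -
  obtain y z where yz: "c = {y, z}" "y \<noteq> z"
    using assms by (auto simp: chord_diagram_def card_2_iff)
  have "y \<in> ends D" "z \<in> ends D" using yz assms(3) by (auto simp: ends_def)
  then obtain s t where "0 < s" "s < 2 * pi" "y = X * cis s" "0 < t" "t < 2 * pi" "z = X * cis t"
    using end_angle[OF assms(1,2)] by metis
  then show ?thesis using that[of s t] that[of t s] yz by (cases s t rule: linorder_cases) auto
qed

lemma gauss_word_single:
  assumes D: "chord_diagram D" and X: "base_point D X" and c: "c \<in> D"
  shows "gauss_word {c} X = [c, c]"
proof -
  obtain a b where ab: "0 < a" "a < b" "b < 2 * pi" "c = {X * cis a, X * cis b}"
    using chord_angles[OF D X c] .
  have X': "X \<in> circle" using X by (simp add: base_point_def)
  have "meeting_angles {c} X = [a, b]"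
    using ab by (intro meeting_angles_eqI) (use X' in \<open>auto simp: ends_def cis_eq_iff_angle\<close>)
  then show ?thesis
    using chord_at_eq[OF chord_diagram_subset[OF D], of "{c}" c] c ab by (simp add: gauss_word_def)
qed

lemma count_list_gauss_word:
  assumes D: "chord_diagram D" and X: "base_point D X" and c: "c \<in> D"
  shows "count_list (gauss_word D X) c = 2"
proof -
  have "filter (\<lambda>d. d \<in> {c}) (gauss_word D X) = [c, c]"
    using gauss_word_subset[OF D X, of "{c}"] gauss_word_single[OF assms] c by simp
  moreover have "(\<lambda>d. d \<in> {c}) = (=) c" by auto
  ultimately show ?thesis by (simp only: count_list_eq_length_filter) simp
qed

lemma set_gauss_word:
  assumes D: "chord_diagram D" and X: "base_point D X"
  shows "set (gauss_word D X) = D"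
proof
  have X': "X \<in> circle" using X by (simp add: base_point_def)
  show "set (gauss_word D X) \<subseteq> D"
    unfolding gauss_word_def set_map meeting_angles(1)[OF D X'] ends_def
    using chord_at_eq[OF D] by force
  show "D \<subseteq> set (gauss_word D X)"
    using count_list_gauss_word[OF D X] by (metis count_list_0_iff subsetI zero_neq_numeral)
qed

text \<open>Restricted to \<open>c\<close> and \<open>d\<close>, the word is that of the diagram
  \<open>{c, d}\<close>. With \<open>s < t\<close> and \<open>a < b\<close> its four end angles
  admit six orders, and in each both notions can be read off.\<close>

lemma linked_iff_interlaced:
  assumes D: "chord_diagram D" and X: "base_point D X" and cd: "c \<in> D" "d \<in> D" "c \<noteq> d"
  shows "linked c d \<longleftrightarrow> interlaced (gauss_word D X) c d"
proof -
  have X': "X \<in> circle" using X by (simp add: base_point_def)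
  obtain s t where st: "0 < s" "s < t" "t < 2 * pi" "c = {X * cis s, X * cis t}"
    using chord_angles[OF D X cd(1)] .
  obtain a b where ab: "0 < a" "a < b" "b < 2 * pi" "d = {X * cis a, X * cis b}"
    using chord_angles[OF D X cd(2)] .
  have "c \<inter> d = {}" using D cd by (auto simp: chord_diagram_def pairwise_def disjnt_def)
  then have ne: "s \<notin> {a, b}" "t \<notin> {a, b}" using st ab by auto
  have CD: "chord_diagram {c, d}" using chord_diagram_subset[OF D] cd by simp
  have at: "chord_at {c, d} (X * cis u) = c" if "u \<in> {s, t}" for u
    using chord_at_eq[OF CD] that st by auto
  have at': "chord_at {c, d} (X * cis u) = d" if "u \<in> {a, b}" for u
    using chord_at_eq[OF CD] that ab by auto
  have word: "filter (\<lambda>x. x = c \<or> x = d) (gauss_word D X) = map (\<lambda>u. if u \<in> {s, t} then c else d) l"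
    if l: "sorted_wrt (<) l" "set l = {s, t, a, b}" for l
  proof -
    have "meeting_angles {c, d} X = l"
    proof (rule meeting_angles_eqI[OF l(1)])
      have "ends {c, d} = (\<lambda>u. X * cis u) ` {s, t, a, b}" unfolding ends_def st(4) ab(4) by blast
      moreover have "0 < u \<and> u < 2 * pi" if "u \<in> {s, t, a, b}" for u using that st ab by auto
      ultimately show "set l = {\<theta> \<in> {0<..<2 * pi}. X * cis \<theta> \<in> ends {c, d}}"
        unfolding l(2) using X' by (auto simp: image_iff cis_eq_iff_angle)
    qed
    then have "gauss_word {c, d} X = map (\<lambda>u. chord_at {c, d} (X * cis u)) l"
      by (simp add: gauss_word_def)
    also have "\<dots> = map (\<lambda>u. if u \<in> {s, t} then c else d) l"
    proof (rule map_cong[OF HOL.refl])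
      fix u assume "u \<in> set l"
      then have "u \<in> {s, t} \<or> u \<in> {a, b} \<and> u \<notin> {s, t}" using l(2) by blast
      then show "chord_at {c, d} (X * cis u) = (if u \<in> {s, t} then c else d)"
        using at[of u] at'[of u] by argo
    qed
    finally have "gauss_word {c, d} X = map (\<lambda>u. if u \<in> {s, t} then c else d) l" .
    then show ?thesis using gauss_word_subset[OF D X, of "{c, d}"] cd by simp
  qed
  have "linked c d \<longleftrightarrow> (s \<in> {a<..<b}) \<noteq> (t \<in> {a<..<b})"
    unfolding st(4) ab(4) by (rule linked_iff_angles[OF X']) (use st ab ne in auto)
  also have "\<dots> \<longleftrightarrow> interlaced (gauss_word D X) c d"
  proof -
    consider "t < a" | "s < a" "a < t" "t < b" | "s < a" "b < t" | "a < s" "t < b"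
      | "a < s" "s < b" "b < t" | "b < s" using ne by force
    then show ?thesis
    proof cases
      case 1
      then show ?thesis using word[of "[s, t, a, b]"] st(1-3) ab(1-3) ne cd(3)
        by (auto simp: interlaced_def insert_commute)
    next
      case 2
      then show ?thesis using word[of "[s, a, t, b]"] st(1-3) ab(1-3) ne cd(3)
        by (auto simp: interlaced_def insert_commute)
    next
      case 3
      then show ?thesis using word[of "[s, a, b, t]"] st(1-3) ab(1-3) ne cd(3)
        by (auto simp: interlaced_def insert_commute)
    next
      case 4
      then show ?thesis using word[of "[a, s, t, b]"] st(1-3) ab(1-3) ne cd(3)
        by (auto simp: interlaced_def insert_commute)
    next
      case 5
      then show ?thesis using word[of "[a, s, b, t]"] st(1-3) ab(1-3) ne cd(3)
        by (auto simp: interlaced_def insert_commute)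
    next
      case 6
      then show ?thesis using word[of "[a, b, s, t]"] st(1-3) ab(1-3) ne cd(3)
        by (auto simp: interlaced_def insert_commute)
    qed
  qed
  finally show ?thesis .
qed

lemma gamma_eq_type_word:
  assumes D: "chord_diagram D" and X: "base_point D X"
  shows "gamma D X = type_word (gauss_word D X)"
proof -
  let ?w = "gauss_word D X"
  have fin: "finite D" using D by (simp add: chord_diagram_def)
  have lk: "card {d \<in> D - {c}. linked c d \<and> P d} = linking_number ?w P' c"
    if "c \<in> D" "\<And>d. d \<in> D \<Longrightarrow> P d = P' d" for P P' c
  proof -
    have "{d \<in> D - {c}. linked c d \<and> P d} = (D - {c}) \<inter> {d. interlaced ?w c d \<and> P' d}"
      using that linked_iff_interlaced[OF D X that(1)] by auto
    then show ?thesis using fin by (simp add: linking_number_def set_gauss_word[OF D X])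
  qed
  have ev: "even_chord D c \<longleftrightarrow> even_in ?w c" if "c \<in> D" for c
    using lk[OF that, of "\<lambda>_. True" "\<lambda>_. True"] by (simp add: even_chord_def)
  have "chord_letter D c = letter_type ?w c" if "c \<in> D" for c
    using lk[OF that, of "\<lambda>d. odd_chord D d" "\<lambda>d. \<not> even_in ?w d"] ev that
    by (simp add: chord_letter_def letter_type_def first_type_def)
  then have "map (chord_letter D) ?w = map (letter_type ?w) ?w"
    by (auto simp: set_gauss_word[OF D X])
  then show ?thesis by (simp add: gamma_def type_word_def gauss_word_def comp_def)
qed

text \<open>With \<open>X' = X * cis p\<close>, the ends at angles \<open>t\<close> above
  \<open>p\<close> are met first from \<open>X'\<close>, at \<open>t - p\<close>; those below
  \<open>p\<close> follow after passing \<open>X\<close>, at \<open>t + 2 * pi - p\<close>.\<close>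

lemma gauss_word_rotation:
  assumes D: "chord_diagram D" and X: "base_point D X" and X': "base_point D X'"
  obtains u v where "gauss_word D X = u @ v" "gauss_word D X' = v @ u"
proof -
  have circ: "X \<in> circle" "X' \<in> circle" using X X' by (simp_all add: base_point_def)
  obtain p where p: "0 \<le> p" "p < 2 * pi" "X' = X * cis p"
    using circle_angle_cases[OF circ] .
  have shift: "X' * cis t = X * cis (p + t)" for t by (simp add: p(3) mult.assoc cis_mult)
  define ts where "ts = meeting_angles D X"
  note ts = meeting_angles[OF D circ(1), folded ts_def]
  have p_notin: "p \<notin> set ts" using X' p by (auto simp: ts base_point_def)
  define u v where "u = filter (\<lambda>t. t < p) ts" and "v = filter (\<lambda>t. p < t) ts"
  have "ts = u @ v"
  proof (rule strict_sorted_equal[OF _ ts(2)])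
    show "sorted_wrt (<) (u @ v)"
      using ts(2) by (auto simp: u_def v_def sorted_wrt_append sorted_wrt_filter)
    have "t < p \<or> p < t" if "t \<in> set ts" for t using that p_notin by (metis linorder_neqE)
    then show "set ts = set (u @ v)" by (auto simp: u_def v_def)
  qed
  have "meeting_angles D X' = map (\<lambda>t. t - p) v @ map (\<lambda>t. t + 2 * pi - p) u"
  proof (rule meeting_angles_eqI)
    show "sorted_wrt (<) (map (\<lambda>t. t - p) v @ map (\<lambda>t. t + 2 * pi - p) u)"
      using ts by (auto simp: u_def v_def sorted_wrt_append sorted_wrt_map sorted_wrt_filter)
    show "set (map (\<lambda>t. t - p) v @ map (\<lambda>t. t + 2 * pi - p) u) =
        {t \<in> {0<..<2 * pi}. X' * cis t \<in> ends D}" (is "?L = ?R")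
    proof
      show "?L \<subseteq> ?R" using p(1,2) by (auto simp: shift u_def v_def ts cis_add_2pi)
      show "?R \<subseteq> ?L"
      proof
        fix t assume t: "t \<in> ?R"
        \<comment> \<open>Equality would mean that the end met at \<open>t\<close> is
          \<open>X\<close>, which is no chord end.\<close>
        have "p + t \<noteq> 2 * pi"
          using t X by (auto simp: shift base_point_def)
        then consider "p + t < 2 * pi" | "p + t > 2 * pi" by linarith
        then show "t \<in> ?L"
        proof cases
          case 1
          then have "p + t \<in> set v" using t p(1,2) by (auto simp: v_def ts shift)
          then show ?thesis by force
        next
          case 2
          have "X * cis (p + t - 2 * pi) = X * cis (p + t)" using cis_add_2pi[of "p + t - 2 * pi"] by simp
          then have "p + t - 2 * pi \<in> set u" using t p(1,2) 2 by (auto simp: u_def ts shift)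
          then show ?thesis by force
        qed
      qed
    qed
  qed
  then have "gauss_word D X' = map (\<lambda>t. chord_at D (X * cis t)) (v @ u)"
    by (simp add: gauss_word_def shift cis_add_2pi add.commute[of _ "2 * pi"])
       (simp add: cis_add_2pi add.commute[of "2 * pi"])
  moreover have "gauss_word D X = map (\<lambda>t. chord_at D (X * cis t)) (u @ v)"
    using \<open>ts = u @ v\<close> by (simp add: gauss_word_def ts_def)
  ultimately show ?thesis using that by simp
qed

lemma gamma_base_point_change:
  assumes D: "chord_diagram D" and X: "base_point D X" and X': "base_point D X'"
  shows "conjugate_in G (G_element (gamma D X)) (G_element (gamma D X'))"
proof -
  obtain u v where "gauss_word D X = u @ v" "gauss_word D X' = v @ u"
    using gauss_word_rotation[OF assms] .
  then show ?thesis
    by (simp add: gamma_eq_type_word[OF D X] gamma_eq_type_word[OF D X'] conjugate_in_G_type_word_rotation)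
qed

section \<open>Invariance\<close>

text \<open>The lift yields a strictly increasing change of angle \<open>k\<close> that fixes 0 and
  \<open>2 * pi\<close>, so the ends are met in the same order. Only the letters are renamed,
  injectively because \<open>h\<close> is injective on the circle.\<close>

lemma gamma_homeomorphism:
  assumes D: "chord_diagram D" and D': "chord_diagram ((\<lambda>c. h ` c) ` D)"
    and h: "orientation_preserving_homeomorphism h" and X: "base_point D X"
  shows "base_point ((\<lambda>c. h ` c) ` D) (h X)" "gamma ((\<lambda>c. h ` c) ` D) (h X) = gamma D X"
proof -
  let ?D' = "(\<lambda>c. h ` c) ` D"
  obtain g where hom: "homeomorphism circle circle h g"
    using h by (auto simp: orientation_preserving_homeomorphism_def)
  then have inj: "inj_on h circle" by (metis homeomorphism_def inj_on_inverseI)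
  obtain f where f: "strict_mono f" "\<And>t. f (t + 2 * pi) = f t + 2 * pi" "\<And>t. h (cis t) = cis (f t)"
    using h unfolding orientation_preserving_homeomorphism_def by blast
  have circ: "X \<in> circle" using X by (simp add: base_point_def)
  obtain s where s: "X = cis s" using circle_angle_cases[of 1 X] circ by auto
  define k where "k t = f (s + t) - f s" for t
  have hk: "h (X * cis t) = h X * cis (k t)" for t
    by (simp add: s cis_mult f(3) k_def)
  have k_mono: "k t < k t' \<longleftrightarrow> t < t'" for t t'
    using f(1) by (simp add: k_def strict_mono_less)
  have k0: "k 0 = 0" "k (2 * pi) = 2 * pi" by (simp_all add: k_def f(2))
  have k_range: "0 < k t \<longleftrightarrow> 0 < t" "k t < 2 * pi \<longleftrightarrow> t < 2 * pi" for t
    using k_mono[of 0 t] k_mono[of t "2 * pi"] by (simp_all add: k0)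
  have hX: "h X \<in> circle" by (simp add: s f(3))
  have ends': "ends ?D' = h ` ends D" by (auto simp: ends_def)
  have "h X \<notin> h ` ends D"
    using inj circ X ends_subset_circle[OF D] by (auto simp: base_point_def dest: inj_onD)
  then show X': "base_point ?D' (h X)" using hX by (simp add: base_point_def ends')
  have at: "chord_at ?D' (h z) = h ` chord_at D z" if z: "z \<in> ends D" for z
  proof -
    obtain c where "c \<in> D" "z \<in> c" using z by (auto simp: ends_def)
    then show ?thesis using chord_at_eq[OF D, of c z] chord_at_eq[OF D', of "h ` c" "h z"] by simp
  qed
  have "meeting_angles ?D' (h X) = map k (meeting_angles D X)"
  proof (rule meeting_angles_eqI)
    show "sorted_wrt (<) (map k (meeting_angles D X))"
      using meeting_angles(2)[OF D circ] by (simp add: sorted_wrt_map k_mono)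
    show "set (map k (meeting_angles D X)) = {t \<in> {0<..<2 * pi}. h X * cis t \<in> ends ?D'}" (is "?L = ?R")
    proof
      show "?L \<subseteq> ?R" by (auto simp: meeting_angles(1)[OF D circ] k_range ends' simp flip: hk)
      show "?R \<subseteq> ?L"
      proof
        fix t' assume t': "t' \<in> ?R"
        then obtain z where z: "z \<in> ends D" "h X * cis t' = h z" by (auto simp: ends')
        obtain t where t: "0 < t" "t < 2 * pi" "z = X * cis t" using end_angle[OF D X z(1)] .
        then have "cis t' = cis (k t)" using z(2) hX by (auto simp: hk)
        then have "t' = k t" using t t' by (subst (asm) cis_eq_iff_angle) (auto simp: k_range)
        then show "t' \<in> ?L" using t z(1) by (auto simp: meeting_angles(1)[OF D circ])
      qed
    qed
  qed
  then have "gauss_word ?D' (h X) = map (\<lambda>t. chord_at ?D' (h (X * cis t))) (meeting_angles D X)"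
    by (simp add: gauss_word_def hk)
  also have "\<dots> = map (\<lambda>c. h ` c) (gauss_word D X)"
    using at meeting_angles(1)[OF D circ] by (simp add: gauss_word_def)
  finally have "type_word (gauss_word ?D' (h X)) = type_word (map (\<lambda>c. h ` c) (gauss_word D X))" by simp
  also have "\<dots> = type_word (gauss_word D X)"
  proof (rule type_word_map)
    have "D \<subseteq> Pow circle" using D by (auto simp: chord_diagram_def)
    then show "inj_on (\<lambda>c. h ` c) (set (gauss_word D X))"
      using inj_on_image_Pow[OF inj] set_gauss_word[OF D X] by (auto intro: inj_on_subset)
  qed
  finally show "gamma ?D' (h X) = gamma D X"
    by (simp add: gamma_eq_type_word[OF D X] gamma_eq_type_word[OF D' X'])
qed

section \<open>Ends on an arc as neighbours in the word\<close>

lemma strict_sorted_split_pair: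
  fixes ts :: "real list"
  assumes "sorted_wrt (<) ts" "l < m" "{t \<in> set ts. l \<le> t \<and> t \<le> m} = {l, m}"
  shows "ts = filter (\<lambda>t. t < l) ts @ [l, m] @ filter (\<lambda>t. m < t) ts"
proof (rule strict_sorted_equal[OF _ assms(1)])
  show "sorted_wrt (<) (filter (\<lambda>t. t < l) ts @ [l, m] @ filter (\<lambda>t. m < t) ts)"
    using assms(1,2) by (auto simp: sorted_wrt_append sorted_wrt_filter)
  have "t < l \<or> m < t \<or> t \<in> {l, m}" if "t \<in> set ts" for t using that assms(3) by force
  moreover have "l \<in> set ts" "m \<in> set ts" using assms(3) by blast+
  ultimately show "set ts = set (filter (\<lambda>t. t < l) ts @ [l, m] @ filter (\<lambda>t. m < t) ts)" by auto
qed

text \<open>Which of \<open>x\<close> and \<open>y\<close> comes first on the arc is open, so the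
  ordered angles \<open>l\<close> and \<open>m\<close> are matched with them only as a set.\<close>

lemma arc_with_ends_angles:
  assumes "arc_with_ends D A x y"
  obtains z \<alpha> l m where "z \<in> circle" "\<alpha> < 2 * pi" "A = (\<lambda>\<theta>. z * cis \<theta>) ` {0<..<\<alpha>}"
    "0 < l" "l < m" "m < \<alpha>" "{z * cis l, z * cis m} = {x, y}"
proof -
  obtain z \<alpha> where A: "z \<in> circle" "\<alpha> < 2 * pi" "A = (\<lambda>\<theta>. z * cis \<theta>) ` {0<..<\<alpha>}"
    using assms by (auto simp: arc_with_ends_def circle_arc_def)
  have "x \<in> A" "y \<in> A" "x \<noteq> y" using assms by (auto simp: arc_with_ends_def)
  obtain a where a: "0 < a" "a < \<alpha>" "x = z * cis a" using \<open>x \<in> A\<close> A(3) by auto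
  obtain b where b: "0 < b" "b < \<alpha>" "y = z * cis b" using \<open>y \<in> A\<close> A(3) by auto
  have "a \<noteq> b" using a b \<open>x \<noteq> y\<close> by auto
  then show ?thesis using that[OF A, of a b] that[OF A, of b a] a b by (cases "a < b") auto
qed

text \<open>The base point is put inside the arc, behind both of its chord ends.\<close>

lemma arc_with_ends_last:
  assumes D: "chord_diagram D" and A: "arc_with_ends D A x y"
  obtains X T a b where "base_point D X" "X \<in> A" "meeting_angles D X = T @ [a, b]"
    "{X * cis a, X * cis b} = {x, y}"
proof -
  obtain z \<alpha> l m where z: "z \<in> circle" "\<alpha> < 2 * pi" "A = (\<lambda>\<theta>. z * cis \<theta>) ` {0<..<\<alpha>}"
    and lm: "0 < l" "l < m" "m < \<alpha>" "{z * cis l, z * cis m} = {x, y}"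
    using arc_with_ends_angles[OF A] .
  have AD: "A \<inter> ends D = {z * cis l, z * cis m}" using A lm(4) by (simp add: arc_with_ends_def)
  have end_cases: "t = l \<or> t = m" if "0 < t" "t < \<alpha>" "z * cis t \<in> ends D" for t
  proof -
    have "z * cis t \<in> A \<inter> ends D" using that z by auto
    then have "cis t = cis l \<or> cis t = cis m" using z(1) unfolding AD by auto
    moreover have "cis t = cis l \<longleftrightarrow> t = l" "cis t = cis m \<longleftrightarrow> t = m"
      by (rule cis_eq_iff_angle; use that z lm in linarith)+
    ultimately show ?thesis by simp
  qed
  \<comment> \<open>The midpoint of the part of the arc beyond its later end.\<close>
  define s where "s = (m + \<alpha>) / 2"
  have s: "m < s" "s < \<alpha>" using lm by (simp_all add: s_def)
  define X where "X = z * cis s"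
  have XA: "X \<in> A" using s lm z by (auto simp: X_def)
  have circ: "X \<in> circle" using z by (simp add: X_def norm_mult)
  have "X \<notin> ends D" using end_cases[of s] s lm by (auto simp: X_def)
  then have X: "base_point D X" using circ by (simp add: base_point_def)
  have shift: "X * cis t = z * cis (s + t - 2 * pi)" for t
    using cis_add_2pi[of "s + t - 2 * pi"] by (simp add: X_def mult.assoc cis_mult)
  \<comment> \<open>Seen from \<open>X\<close>, the two ends lie shortly before the completion of a
    full turn, hence the added \<open>2 * pi\<close>.\<close>
  define L M where "L = l - s + 2 * pi" and "M = m - s + 2 * pi"
  have XL: "X * cis L = z * cis l" "X * cis M = z * cis m" by (simp_all add: shift L_def M_def)
  let ?ts = "meeting_angles D X"
  note ts = meeting_angles[OF D circ]
  \<comment> \<open>From angle \<open>L\<close> to the full turn the walk stays on the arc, which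
    carries no further ends.\<close>
  have late: "t = L \<or> t = M" if "t \<in> set ?ts" "L \<le> t" for t
    using that end_cases[of "s + t - 2 * pi"] s lm by (auto simp: ts shift L_def M_def)
  have "z * cis l \<in> ends D" "z * cis m \<in> ends D" using AD by blast+
  then have mem: "L \<in> set ?ts" "M \<in> set ?ts"
    unfolding ts(1) using s lm z(2) by (simp_all add: XL) (simp_all add: L_def M_def)
  have LM: "L < M" using lm by (simp add: L_def M_def)
  have "?ts = filter (\<lambda>t. t < L) ?ts @ [L, M] @ filter (\<lambda>t. M < t) ?ts"
    by (rule strict_sorted_split_pair[OF ts(2) LM]) (use late mem LM in auto)
  moreover have "filter (\<lambda>t. M < t) ?ts = []" using late LM by (force simp: filter_empty_conv)
  ultimately have "?ts = filter (\<lambda>t. t < L) ?ts @ [L, M]" by simp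
  then show ?thesis using that[OF X XA] XL lm(4) by metis
qed

text \<open>An arc that avoids \<open>X\<close> does not wrap around: its angles seen from
  \<open>X\<close> form a single interval between 0 and \<open>2 * pi\<close>, so its two ends are
  neighbours in the sorted list.\<close>

lemma arc_with_ends_consecutive:
  assumes D: "chord_diagram D" and X: "base_point D X" and A: "arc_with_ends D A x y" "X \<notin> A"
  obtains T a b U where "meeting_angles D X = T @ [a, b] @ U" "{X * cis a, X * cis b} = {x, y}"
proof -
  obtain z \<alpha> l m where z: "z \<in> circle" "\<alpha> < 2 * pi" "A = (\<lambda>\<theta>. z * cis \<theta>) ` {0<..<\<alpha>}"
    and lm: "0 < l" "l < m" "m < \<alpha>" "{z * cis l, z * cis m} = {x, y}"
    using arc_with_ends_angles[OF A(1)] .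
  have circ: "X \<in> circle" using X by (simp add: base_point_def)
  obtain p where p: "0 \<le> p" "p < 2 * pi" "z = X * cis p"
    using circle_angle_cases[OF circ z(1)] .
  have shift: "z * cis t = X * cis (p + t)" for t by (simp add: p(3) mult.assoc cis_mult)
  have A_eq: "A = (\<lambda>t. X * cis t) ` {p<..<p + \<alpha>}"
  proof -
    have "A = (\<lambda>t. X * cis t) ` ((+) p ` {0<..<\<alpha>})" unfolding z(3) by (simp add: shift image_image)
    moreover have "(+) p ` {0<..<\<alpha>} = {p<..<p + \<alpha>}"
      by (auto intro: image_eqI[of _ _ "t - p" for t])
    ultimately show ?thesis by simp
  qed
  have "p + \<alpha> \<le> 2 * pi"
  proof (rule ccontr)
    assume "\<not> p + \<alpha> \<le> 2 * pi"
    \<comment> \<open>\<open>X\<close> itself has angle \<open>2 * pi\<close>, so an arc reaching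
      beyond this angle would contain it.\<close>
    then have "X * cis (2 * pi) \<in> A" unfolding A_eq using p by (intro imageI) simp
    then show False using A(2) by simp
  qed
  define L M where "L = p + l" and "M = p + m"
  have XL: "X * cis L = z * cis l" "X * cis M = z * cis m" by (simp_all add: shift L_def M_def)
  have LM: "p < L" "L < M" "M < p + \<alpha>" using lm by (simp_all add: L_def M_def)
  let ?ts = "meeting_angles D X"
  note ts = meeting_angles[OF D circ]
  have AD: "A \<inter> ends D = {X * cis L, X * cis M}" using A(1) lm(4) by (simp add: arc_with_ends_def XL)
  then have "X * cis L \<in> ends D" "X * cis M \<in> ends D" by blast+
  then have mem: "L \<in> set ?ts" "M \<in> set ?ts"
    unfolding ts(1) using LM p \<open>p + \<alpha> \<le> 2 * pi\<close> by simp_all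
  have between: "t = L \<or> t = M" if "t \<in> set ?ts" "L \<le> t" "t \<le> M" for t
  proof -
    have "X * cis t \<in> A \<inter> ends D" unfolding A_eq using that LM ts by auto
    then have "cis t = cis L \<or> cis t = cis M" using circ unfolding AD by auto
    moreover have "cis t = cis L \<longleftrightarrow> t = L" "cis t = cis M \<longleftrightarrow> t = M"
      by (rule cis_eq_iff_angle; use that mem in \<open>simp add: ts\<close>)+
    ultimately show ?thesis by simp
  qed
  have "?ts = filter (\<lambda>t. t < L) ?ts @ [L, M] @ filter (\<lambda>t. M < t) ?ts"
    by (rule strict_sorted_split_pair[OF ts(2) LM(2)]) (use between mem LM in auto)
  then show ?thesis using that XL lm(4) by metis
qed

text \<open>Pairs of neighbours without a common entry cannot overlap, so one stands wholly before
  the other.\<close>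

lemma append_pairs_eq_append_pairs:
  assumes "xs @ [a, b] @ ys = us @ [c, d] @ vs" "{a, b} \<inter> {c, d} = {}"
  obtains t where "us = xs @ [a, b] @ t" "ys = t @ [c, d] @ vs"
    | t where "xs = us @ [c, d] @ t" "vs = t @ [a, b] @ ys"
proof -
  obtain zs where "xs = us @ zs \<and> zs @ [a, b] @ ys = [c, d] @ vs \<or>
      xs @ zs = us \<and> [a, b] @ ys = zs @ [c, d] @ vs"
    using assms(1) unfolding append_eq_append_conv2 by blast
  \<comment> \<open>A difference \<open>zs\<close> of the two prefixes of length 0 or 1 would make
    the pairs share an entry.\<close>
  moreover have "zs = [] \<or> (\<exists>z. zs = [z]) \<or> (\<exists>z z' t. zs = z # z' # t)"
    by (metis list.exhaust)
  ultimately show ?thesis using that assms(2) by auto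
qed

lemma chord_pair_word:
  assumes D: "chord_diagram D" and c: "p \<in> D" "q \<in> D" "x \<in> p" "y \<in> q"
    and "{f a, f b} = {x, y}"
  shows "map (\<lambda>t. chord_at D (f t)) [a, b] = [p, q] \<or> map (\<lambda>t. chord_at D (f t)) [a, b] = [q, p]"
proof -
  have "f a = x \<and> f b = y \<or> f a = y \<and> f b = x" using assms(6) by (auto simp: doubleton_eq_iff)
  then show ?thesis using chord_at_eq[OF D c(1,3)] chord_at_eq[OF D c(2,4)] by auto
qed

section \<open>Each move at a suitable base point\<close>

text \<open>With the base point behind both ends of the new chord, its two letters close the word,
  and filtering them out leaves the word of \<open>D\<close>.\<close>

lemma add_chord_move_gamma:
  assumes D: "chord_diagram D" and D': "chord_diagram D'" and move: "add_chord_move D D'"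
  obtains X where "base_point D X" "base_point D' X" "G_element (gamma D' X) = G_element (gamma D X)"
proof -
  obtain x y A where p: "{x, y} \<notin> D" "D' = D \<union> {{x, y}}" "arc_with_ends D' A x y"
    using move by (auto simp: add_chord_move_def)
  obtain X T a b where X: "base_point D' X" "meeting_angles D' X = T @ [a, b]" "{X * cis a, X * cis b} = {x, y}"
    using arc_with_ends_last[OF D' p(3)] by metis
  have XD: "base_point D X" using base_point_subset[OF X(1)] p(2) by auto
  have pD: "{x, y} \<in> D'" using p(2) by simp
  define u where "u = map (\<lambda>t. chord_at D' (X * cis t)) T"
  have word: "gauss_word D' X = u @ [{x, y}, {x, y}]"
    using chord_pair_word[OF D' pD pD, of x y "\<lambda>t. X * cis t", OF _ _ X(3)]
    by (simp add: gauss_word_def X(2) u_def)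
  have notin: "{x, y} \<notin> set u"
    using count_list_gauss_word[OF D' X(1) pD] by (simp add: word flip: count_list_0_iff)
  have "set u \<subseteq> D'" using set_gauss_word[OF D' X(1), unfolded word] by auto
  then have "set u \<subseteq> D" using notin p(2) by blast
  moreover have "D \<subseteq> D'" using p(2) by blast
  ultimately have "gauss_word D X = u"
    using gauss_word_subset[OF D' X(1), of D, unfolded word] p(1) by (simp add: filter_id_conv subset_iff)
  then have "G_element (gamma D' X) = G_element (gamma D X)"
    using type_word_kink[OF notin]
    by (simp add: gamma_eq_type_word[OF D XD] gamma_eq_type_word[OF D' X(1)] word)
  then show ?thesis using that XD X(1) by blast
qed

text \<open>The base point in \<open>A\<close> puts the pair on \<open>A\<close> last;
  \<open>B\<close> avoids it, so the pair on \<open>B\<close> stands unbroken further to the left.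
  This is the shape treated by \<open>type_word_bigon\<close>.\<close>

lemma add_two_chords_move_gamma:
  assumes D: "chord_diagram D" and D': "chord_diagram D'" and move: "add_two_chords_move D D'"
  obtains X where "base_point D X" "base_point D' X" "G_element (gamma D' X) = G_element (gamma D X)"
proof -
  obtain p q p1 p2 q1 q2 A B where pq: "p = {p1, p2}" "q = {q1, q2}" "p \<noteq> q" "p \<notin> D" "q \<notin> D"
    "D' = D \<union> {p, q}" "disjnt A B" and arcs: "arc_with_ends D' A p1 q1" "arc_with_ends D' B p2 q2"
    using move unfolding add_two_chords_move_def by blast
  have pqD: "p \<in> D'" "q \<in> D'" using pq(6) by simp_all
  obtain X T a b where X: "base_point D' X" "X \<in> A" "meeting_angles D' X = T @ [a, b]"
    "{X * cis a, X * cis b} = {p1, q1}"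
    using arc_with_ends_last[OF D' arcs(1)] by metis
  have "X \<notin> B" using X(2) pq(7) by (auto simp: disjnt_def)
  then obtain U c d V where UV: "meeting_angles D' X = U @ [c, d] @ V" "{X * cis c, X * cis d} = {p2, q2}"
    using arc_with_ends_consecutive[OF D' X(1) arcs(2)] by metis
  have card2: "card p = 2" "card q = 2" and "p \<inter> q = {}"
    using D' pqD pq(3) by (auto simp: chord_diagram_def pairwise_def disjnt_def)
  then have "{p2, q2} \<inter> {p1, q1} = {}" unfolding pq(1,2) by (auto simp: card_2_iff' )
  then have "{c, d} \<inter> {a, b} = {}" unfolding X(4)[symmetric] UV(2)[symmetric] by blast
  moreover have "U @ [c, d] @ V = T @ [a, b] @ []" using X(3) UV(1) by simp
  ultimately obtain t where "V = t @ [a, b]"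
    using append_pairs_eq_append_pairs[of U c d V T a b "[]"] by (metis append_is_Nil_conv list.distinct(1) append_Nil2)
  then have ma: "meeting_angles D' X = U @ [c, d] @ t @ [a, b]" using UV(1) by simp
  have XD: "base_point D X" using base_point_subset[OF X(1)] pq(6) by auto
  let ?f = "\<lambda>t. chord_at D' (X * cis t)"
  define u v s s' where "u = map ?f U" and "v = map ?f t" and "s = map ?f [c, d]" and "s' = map ?f [a, b]"
  have word: "gauss_word D' X = u @ s @ v @ s'"
    unfolding gauss_word_def ma u_def v_def s_def s'_def by (simp only: map_append)
  have s: "s = [p, q] \<or> s = [q, p]" "s' = [p, q] \<or> s' = [q, p]"
    unfolding s_def s'_def
    using chord_pair_word[OF D' pqD, of p2 q2 "\<lambda>t. X * cis t", OF _ _ UV(2)]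
      chord_pair_word[OF D' pqD, of p1 q1 "\<lambda>t. X * cis t", OF _ _ X(4)]
    by (simp_all add: pq(1,2))
  have notin: "p \<notin> set u \<union> set v" "q \<notin> set u \<union> set v"
  proof -
    have "count_list u c + count_list v c = 0" if "c = p \<or> c = q" for c
      using count_list_gauss_word[OF D' X(1), of c] that pqD s pq(3) unfolding word
      by (elim disjE) simp_all
    then show "p \<notin> set u \<union> set v" "q \<notin> set u \<union> set v"
      by (simp_all flip: count_list_0_iff)
  qed
  have "set u \<subseteq> D'" "set v \<subseteq> D'" using set_gauss_word[OF D' X(1), unfolded word] by auto
  then have "set u \<subseteq> D" "set v \<subseteq> D" using notin pq(6) by blast+
  moreover have "D \<subseteq> D'" using pq(6) by blast
  moreover have "filter (\<lambda>c. c \<in> D) s = []" "filter (\<lambda>c. c \<in> D) s' = []" using s pq(4,5) by auto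
  ultimately have "gauss_word D X = u @ v"
    using gauss_word_subset[OF D' X(1), of D, unfolded word] by (simp add: filter_id_conv subset_iff)
  then have "G_element (gamma D' X) = G_element (gamma D X)"
    using type_word_bigon[OF pq(3) notin s]
    by (simp add: gamma_eq_type_word[OF D XD] gamma_eq_type_word[OF D' X(1)] word)
  then show ?thesis using that XD X(1) by blast
qed

text \<open>The switch is an involution preserving the set of ends, so \<open>D\<close> and
  \<open>D'\<close> share base points and meeting angles. The chord of \<open>D'\<close> at
  \<open>z\<close> is the image of the chord of \<open>D\<close> at \<open>sw z\<close>; up to this
  renaming, the word of \<open>D'\<close> is that of \<open>D\<close> with three pairs
  reversed.\<close>

lemma three_chords_move_gamma:
  assumes D: "chord_diagram D" and D': "chord_diagram D'" and move: "three_chords_move D D'"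
  obtains X where "base_point D X" "base_point D' X" "G_element (gamma D' X) = G_element (gamma D X)"
proof -
  obtain p q r p1 p2 q1 q2 r1 r2 A B C where *: "p = {p1, p2} \<and> q = {q1, q2} \<and> r = {r1, r2} \<and>
        p \<noteq> q \<and> q \<noteq> r \<and> p \<noteq> r \<and> p \<in> D \<and> q \<in> D \<and> r \<in> D \<and>
        disjnt A B \<and> disjnt B C \<and> disjnt A C \<and>
        arc_with_ends D A p1 q1 \<and> arc_with_ends D B q2 r1 \<and> arc_with_ends D C p2 r2 \<and>
        D' = (\<lambda>c. (Transposition.transpose p1 q1 \<circ> Transposition.transpose q2 r1 \<circ>
          Transposition.transpose p2 r2) ` c) ` D"
    using move unfolding three_chords_move_def Let_def by - (elim exE, rule that)
  have pqr: "p = {p1, p2}" "q = {q1, q2}" "r = {r1, r2}"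
    "p \<noteq> q" "q \<noteq> r" "p \<noteq> r" "p \<in> D" "q \<in> D" "r \<in> D"
    and disj: "disjnt A B" "disjnt B C" "disjnt A C"
    and arcs: "arc_with_ends D A p1 q1" "arc_with_ends D B q2 r1" "arc_with_ends D C p2 r2"
    and D'_raw: "D' = (\<lambda>c. (Transposition.transpose p1 q1 \<circ> Transposition.transpose q2 r1 \<circ>
        Transposition.transpose p2 r2) ` c) ` D"
    by (insert *, elim conjE, assumption)+
  define sw where "sw = Transposition.transpose p1 q1 \<circ> Transposition.transpose q2 r1 \<circ> Transposition.transpose p2 r2"
  have D'_eq: "D' = (\<lambda>c. sw ` c) ` D" using D'_raw by (simp add: sw_def)
  have card2: "card p = 2" "card q = 2" "card r = 2" using D pqr(7-9) by (simp_all add: chord_diagram_def)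
  then have ne: "p1 \<noteq> p2" "q1 \<noteq> q2" "r1 \<noteq> r2" unfolding pqr(1-3) by fastforce+
  have int: "p \<inter> q = {}" "q \<inter> r = {}" "p \<inter> r = {}"
    using D pqr(4-9) by (simp_all add: chord_diagram_def pairwise_def disjnt_def)
  have six: "distinct [p1, q1, q2, r1, p2, r2]" using ne int unfolding pqr(1-3) by auto
  \<comment> \<open>The six ends are distinct, so the transpositions have disjoint supports and each
    acts on its own pair.\<close>
  have sw: "sw p1 = q1" "sw q1 = p1" "sw q2 = r1" "sw r1 = q2" "sw p2 = r2" "sw r2 = p2"
    "\<And>z. z \<notin> {p1, q1, q2, r1, p2, r2} \<Longrightarrow> sw z = z"
    using six six[folded distinct_rev[of "[p1, q1, q2, r1, p2, r2]"]] unfolding sw_def Transposition.transpose_def comp_def by simp_all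
  have sw_sw: "sw (sw z) = z" for z
  proof (cases "z \<in> {p1, q1, q2, r1, p2, r2}")
    case True
    then show ?thesis by (elim insertE emptyE) (simp_all only: sw(1-6))
  next
    case False
    show ?thesis by (simp only: sw(7)[OF False])
  qed
  have inj: "inj sw" by (metis injI sw_sw)
  have inj_image: "inj_on (\<lambda>c. sw ` c) S" for S
    by (rule inj_onI) (simp add: inj_image_eq_iff[OF inj])
  have six_ends: "{p1, q1, q2, r1, p2, r2} \<subseteq> ends D" using pqr(7-9) unfolding pqr(1-3) ends_def by blast
  have sw_ends: "sw z \<in> ends D" if "z \<in> ends D" for z
  proof (cases "z \<in> {p1, q1, q2, r1, p2, r2}")
    case True
    then show ?thesis using six_ends by (elim insertE emptyE) (simp_all add: sw(1-6))
  next
    case False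
    then show ?thesis using that by (simp only: sw(7)[OF False])
  qed
  have "ends D' = sw ` ends D" by (auto simp: D'_eq ends_def)
  also have "\<dots> = ends D"
  proof
    show "ends D \<subseteq> sw ` ends D" using sw_ends sw_sw by (metis imageI subsetI)
  qed (use sw_ends in blast)
  finally have ends': "ends D' = ends D" .
  have at': "chord_at D' z = sw ` chord_at D (sw z)" if z: "z \<in> ends D" for z
  proof -
    obtain c where c: "c \<in> D" "sw z \<in> c" using sw_ends[OF z] by (auto simp: ends_def)
    have "z \<in> sw ` c" using c(2) sw_sw[of z] by (metis imageI)
    then show ?thesis using chord_at_eq[OF D c] chord_at_eq[OF D', of "sw ` c" z] c(1) D'_eq by simp
  qed

  obtain X T a1 a2 where X: "base_point D X" "X \<in> A" and T: "meeting_angles D X = T @ [a1, a2]"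
    "{X * cis a1, X * cis a2} = {p1, q1}"
    using arc_with_ends_last[OF D arcs(1)] by metis
  have circ: "X \<in> circle" using X(1) by (simp add: base_point_def)
  have XBC: "X \<notin> B" "X \<notin> C" using X(2) disj by (auto simp: disjnt_def)
  obtain U b1 b2 U' where U: "meeting_angles D X = U @ [b1, b2] @ U'" "{X * cis b1, X * cis b2} = {q2, r1}"
    using arc_with_ends_consecutive[OF D X(1) arcs(2) XBC(1)] .
  obtain V c1 c2 V' where V: "meeting_angles D X = V @ [c1, c2] @ V'" "{X * cis c1, X * cis c2} = {p2, r2}"
    using arc_with_ends_consecutive[OF D X(1) arcs(3) XBC(2)] .
  have X': "base_point D' X" using X(1) by (simp add: base_point_def ends')
  have ma': "meeting_angles D' X = meeting_angles D X" by (simp add: meeting_angles_def ends')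

  have "{X * cis a1, X * cis a2} \<inter> {X * cis b1, X * cis b2} = {}"
    "{X * cis a1, X * cis a2} \<inter> {X * cis c1, X * cis c2} = {}"
    "{X * cis b1, X * cis b2} \<inter> {X * cis c1, X * cis c2} = {}"
    unfolding T(2) U(2) V(2) using six by auto
  then have abc: "{b1, b2} \<inter> {a1, a2} = {}" "{c1, c2} \<inter> {a1, a2} = {}" "{b1, b2} \<inter> {c1, c2} = {}" by blast+
  have last: "\<exists>t. ys = t @ [a1, a2]" if "meeting_angles D X = xs @ [x, y] @ ys" "{x, y} \<inter> {a1, a2} = {}" for xs x y ys
  proof -
    have "xs @ [x, y] @ ys = T @ [a1, a2] @ []" using that(1) T(1) by simp
    then show ?thesis using that(2) by (rule append_pairs_eq_append_pairs) auto
  qed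
  let ?f = "\<lambda>t. chord_at D (X * cis t)" and ?g = "\<lambda>t. chord_at D (sw (X * cis t))"
  have pair: "map ?f [t, t'] = [c, d] \<or> map ?f [t, t'] = [d, c]" "map ?g [t, t'] = rev (map ?f [t, t'])"
    if "{X * cis t, X * cis t'} = {x, y}" "c \<in> D" "d \<in> D" "x \<in> c" "y \<in> d" "sw x = y" "sw y = x" for t t' x y c d
  proof -
    show "map ?f [t, t'] = [c, d] \<or> map ?f [t, t'] = [d, c]"
      using chord_pair_word[OF D that(2-5), of "\<lambda>t. X * cis t", OF that(1)] .
    have "X * cis t = x \<and> X * cis t' = y \<or> X * cis t = y \<and> X * cis t' = x"
      using that(1) by (auto simp: doubleton_eq_iff)
    then show "map ?g [t, t'] = rev (map ?f [t, t'])" using that(6,7) by auto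
  qed
  have mem: "p1 \<in> p" "p2 \<in> p" "q1 \<in> q" "q2 \<in> q" "r1 \<in> r" "r2 \<in> r" using pqr(1-3) by auto
  note a = pair[OF T(2) pqr(7,8) mem(1,3) sw(1,2)] and b = pair[OF U(2) pqr(8,9) mem(4,5) sw(3,4)]
    and c = pair[OF V(2) pqr(7,9) mem(2,6) sw(5,6)]
  have rest: "map ?g l = map ?f l"
    if "set l \<subseteq> set (meeting_angles D X)" "set l \<inter> {a1, a2, b1, b2, c1, c2} = {}" for l
  proof -
    have "sw (X * cis t) = X * cis t" if t: "t \<in> set l" for t
    proof -
      have "X * cis t \<noteq> X * cis t'" if "t' \<in> {a1, a2, b1, b2, c1, c2}" for t'
      proof -
        have "t' \<in> set (meeting_angles D X)" using that T(1) U(1) V(1) by (metis (no_types, lifting) Un_iff insert_iff list.set set_append singletonD)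
        moreover have "t \<in> set (meeting_angles D X)" using t \<open>set l \<subseteq> set (meeting_angles D X)\<close> by blast
        ultimately have "0 < t" "t < 2 * pi" "0 < t'" "t' < 2 * pi"
          unfolding meeting_angles(1)[OF D circ] by simp_all
        then have "X * cis t = X * cis t' \<longleftrightarrow> t = t'" by (intro circle_eq_iff_near[OF circ]) simp
        then show ?thesis using that t \<open>set l \<inter> {a1, a2, b1, b2, c1, c2} = {}\<close> by blast
      qed
      then have "X * cis t \<notin> {p1, q1} \<union> {q2, r1} \<union> {p2, r2}"
        unfolding T(2)[symmetric] U(2)[symmetric] V(2)[symmetric] by blast
      then show ?thesis using sw(7) by blast
    qed
    then show ?thesis by simp
  qed
  have dist: "distinct (meeting_angles D X)"
    using meeting_angles(2)[OF D circ] by (simp add: strict_sorted_iff)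
  have twice: "count_list (map ?f (meeting_angles D X)) e = 2" if "e \<in> set (map ?f (meeting_angles D X))" for e
    using count_list_gauss_word[OF D X(1), of e] set_gauss_word[OF D X(1)] that by (simp add: gauss_word_def)
  have pqr_distinct: "distinct [q, r, p]" "distinct [p, r, q]" using pqr(4-6) by auto

  have "gauss_word D' X = map (\<lambda>c. sw ` c) (map ?g (meeting_angles D X))"
    using at' meeting_angles(1)[OF D circ] by (simp add: gauss_word_def ma')
  then have "type_word (gauss_word D' X) = type_word (map ?g (meeting_angles D X))"
    by (simp only: type_word_map[OF inj_image])
  moreover have "G_element (type_word (map ?g (meeting_angles D X))) = G_element (type_word (map ?f (meeting_angles D X)))"
  proof -
    have "U @ [b1, b2] @ U' = V @ [c1, c2] @ V'" using U(1) V(1) by simp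
    \<comment> \<open>From \<open>X\<close>, either \<open>B\<close> or \<open>C\<close> is met
      first; each order fits \<open>type_word_triangle\<close> with its own assignment of the three
      roles.\<close>
    then consider t where "V = U @ [b1, b2] @ t" "U' = t @ [c1, c2] @ V'"
      | t where "U = V @ [c1, c2] @ t" "V' = t @ [b1, b2] @ U'"
      using abc(3) by (rule append_pairs_eq_append_pairs)
    then show ?thesis
    proof cases
      case 1
      obtain w where w: "V' = w @ [a1, a2]" using last[OF V(1) abc(2)] by blast
      have ma: "meeting_angles D X = U @ [b1, b2] @ t @ [c1, c2] @ w @ [a1, a2]" using V(1) 1 w by simp
      have "map ?g U = map ?f U" "map ?g t = map ?f t" "map ?g w = map ?f w"
        by (rule rest; use dist in \<open>auto simp: ma\<close>)+
      then show ?thesis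
        unfolding ma map_append b(2) c(2) a(2)
        using type_word_triangle[OF pqr_distinct(1) _ b(1), of "map ?f U" "map ?f t" "map ?f [c1, c2]" "map ?f w" "map ?f [a1, a2]"]
          twice[unfolded ma map_append] a(1) c(1) by metis
    next
      case 2
      obtain w where w: "U' = w @ [a1, a2]" using last[OF U(1) abc(1)] by blast
      have ma: "meeting_angles D X = V @ [c1, c2] @ t @ [b1, b2] @ w @ [a1, a2]" using U(1) 2 w by simp
      have "map ?g V = map ?f V" "map ?g t = map ?f t" "map ?g w = map ?f w"
        by (rule rest; use dist in \<open>auto simp: ma\<close>)+
      then show ?thesis
        unfolding ma map_append b(2) c(2) a(2)
        using type_word_triangle[OF pqr_distinct(2) _ c(1), of "map ?f V" "map ?f t" "map ?f [b1, b2]" "map ?f w" "map ?f [a1, a2]"]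
          twice[unfolded ma map_append] a(1) b(1) by metis
    qed
  qed
  ultimately have "G_element (gamma D' X) = G_element (gamma D X)"
    unfolding gamma_eq_type_word[OF D X(1)] gamma_eq_type_word[OF D' X'] by (simp add: gauss_word_def)
  then show ?thesis using that X(1) X' by blast
qed

section \<open>From single moves to equivalence\<close>

lemma base_point_exists:
  assumes "chord_diagram D"
  obtains X where "base_point D X"
proof -
  have "inj_on cis {0<..<1}"
    by (rule inj_onI) (use pi_gt3 in \<open>auto simp: cis_eq_iff_near\<close>)
  then have "infinite (cis ` {0<..<1})" using finite_imageD infinite_Ioo[of 0 "1 :: real"] by fastforce
  then have "\<not> cis ` {0<..<1} \<subseteq> ends D" using finite_ends[OF assms] finite_subset by blast
  then obtain t where "cis t \<notin> ends D" by blast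
  then show ?thesis using that[of "cis t"] by (simp add: base_point_def)
qed

lemma diagram_step_gamma:
  assumes "diagram_step D D'"
  obtains X X' where "base_point D X" "base_point D' X'" "G_element (gamma D' X') = G_element (gamma D X)"
proof -
  have D: "chord_diagram D" "chord_diagram D'" using assms by (auto simp: diagram_step_def)
  consider "same_diagram D D'" | "add_chord_move D D'" | "add_two_chords_move D D'" | "three_chords_move D D'"
    using assms by (auto simp: diagram_step_def)
  then show ?thesis
  proof cases
    case 1
    then obtain h where h: "orientation_preserving_homeomorphism h" "D' = (\<lambda>c. h ` c) ` D"
      by (auto simp: same_diagram_def)
    obtain X where X: "base_point D X" using base_point_exists[OF D(1)] .
    show ?thesis
      using that[OF X] gamma_homeomorphism[OF D(1) _ h(1) X] D(2) unfolding h(2) by metis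
  next
    case 2
    then show ?thesis using add_chord_move_gamma[OF D] that by metis
  next
    case 3
    then show ?thesis using add_two_chords_move_gamma[OF D] that by metis
  next
    case 4
    then show ?thesis using three_chords_move_gamma[OF D] that by metis
  qed
qed

text \<open>A step is controlled only at some base points \<open>Y\<close> and \<open>Y'\<close>;
  changing the base point on both sides reaches the given ones.\<close>

lemma diagram_step_conjugate:
  assumes "diagram_step D D'" "base_point D X" "base_point D' X'"
  shows "conjugate_in G (G_element (gamma D X)) (G_element (gamma D' X'))"
proof -
  obtain Y Y' where Y: "base_point D Y" "base_point D' Y'" "G_element (gamma D' Y') = G_element (gamma D Y)"
    using diagram_step_gamma[OF assms(1)] .
  have D: "chord_diagram D" "chord_diagram D'" using assms by (auto simp: diagram_step_def)
  show ?thesis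
    using conjugate_in_trans[OF group_G gamma_base_point_change[OF D(1) assms(2) Y(1)]]
      gamma_base_point_change[OF D(2) Y(2) assms(3)] Y(3) by simp
qed

text \<open>Intermediate diagrams have no preferred base point, so \<open>X'\<close> stays arbitrary
  in the induction. Steps may run backwards, which the symmetry of conjugacy absorbs.\<close>

lemma equivclp_diagram_step_conjugate:
  assumes "equivclp diagram_step D D'" "chord_diagram D" "base_point D X" "base_point D' X'"
  shows "conjugate_in G (G_element (gamma D X)) (G_element (gamma D' X'))"
  using assms(1,4)
proof (induction arbitrary: X' rule: equivclp_induct)
  case base
  then show ?case by (rule gamma_base_point_change[OF assms(2,3)])
next
  case (step E F)
  obtain Y where Y: "base_point E Y" using step.hyps(2) diagram_step_gamma by metis
  have "conjugate_in G (G_element (gamma E Y)) (G_element (gamma F X'))"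
    using step.hyps(2) diagram_step_conjugate Y step.prems conjugate_in_sym[OF group_G] by blast
  then show ?case using conjugate_in_trans[OF group_G step.IH[OF Y]] by blast
qed

theorem corollary2:
  fixes D D' :: "chord set" and X X' :: complex
  assumes "chord_diagram D" and "chord_diagram D'"
    and "free_knot D = free_knot D'"
    and "base_point D X" and "base_point D' X'"
  shows "conjugate_in G (G_element (gamma D X)) (G_element (gamma D' X'))"
proof -
  \<comment> \<open>By reflexivity \<open>D'\<close> lies in its own class, so equality of the
    classes yields a chain of moves from \<open>D\<close> to \<open>D'\<close>.\<close>
  have "D' \<in> free_knot D'" using assms(2) by (simp add: free_knot_def free_knot_equiv_def)
  then have "D' \<in> free_knot D" by (simp only: assms(3))
  then have "equivclp diagram_step D D'" by (simp add: free_knot_def free_knot_equiv_def)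
  then show ?thesis using assms by (intro equivclp_diagram_step_conjugate)
qed

end
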